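(* Let $A\in\mathbb R^{n\times n}$ be stable. For fixed $\omega$, the optimal value of the inner optimization program $$\max_{\delta\in[-1,1]}\overline\sigma\left(\left(j\omega I-\left(\tfrac{1-\delta}{1+\delta}A-I\right)\right)^{-1}\right)$$ (where for $\delta=-1$ the matrix inside $\overline\sigma$ is understood to be the zero matrix) may be obtained by the following convex semi-definite program (SDP), in which $\epsilon>0$ is arbitrarily small: $$\begin{array}{ll}\text{minimize}&\gamma\\ \text{subject to}& X,Y\in\mathbb C^{n\times n},\ X=X^H,\ Y^H=-Y,\ \gamma\in\mathbb R,\\[4pt] &\begin{bmatrix}P(j\omega)\\ I_{2n}\end{bmatrix}^H\begin{bmatrix}X&0&Y&0\\ 0&I_n&0&0\\ Y^H&0&-X&0\\ 0&0&0&-\gamma^2I_n\end{bmatrix}\begin{bmatrix}P(j\omega)\\ I_{2n}\end{bmatrix}\preceq-\epsilon I.\end{array}$$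
   Context: A matrix is stable if all its eigenvalues have strictly negative real part; $\overline\sigma$ denotes the maximum singular value; $j$ is the imaginary unit; $M^H$ is the conjugate transpose; $\preceq$ refers to the semidefinite order on Hermitian matrices. The frequency $\omega$ ranges over $[0,\infty]$. $P(s)$ is the $2n\times 2n$ transfer function from $(w_\delta,w)$ to $(z_\delta,z)$ of the system $$\dot x=Ax-x+\sqrt2\,w_\delta+w,\qquad z_\delta=-\sqrt2\,Ax-w_\delta,\qquad z=x,$$ i.e. $$P(s)=\begin{bmatrix}-I_n&0\\ 0&0\end{bmatrix}+\begin{bmatrix}-\sqrt2\,A\\ I_n\end{bmatrix}\left(sI_n-(A-I_n)\right)^{-1}\begin{bmatrix}\sqrt2\,I_n& I_n\end{bmatrix}.$$ Closing the loop $w_\delta=\delta z_\delta$ around $P$ gives the transfer function $\left(sI-\left(\tfrac{1-\delta}{1+\delta}A-I\right)\right)^{-1}$ from $w$ to $z$. The maximum over $\omega\in[0,\infty]$ of the inner program's value is the Kreiss constant $K(A)=\max_{\mathrm{Re}(s)>0}\mathrm{Re}(s)\,\|(sI-A)^{-1}\|$, where $\|\cdot\|$ is the spectral norm.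
   Formalization: X is required to be positive semidefinite (with X only Hermitian the claim is false), γ ≥ 0 is required (otherwise unbounded below), ω is finite (at ω = ∞ the SDP is infeasible), and "ε arbitrarily small" means the SDP value converges to the maximum as ε → 0+. *)

theory Defs
  imports "HOL-Analysis.Analysis"
begin

section \<open>Complex matrices\<close>

definition complex_matrix :: "real^'n^'m \<Rightarrow> complex^'n^'m" where
  "complex_matrix A = (\<chi> i j. complex_of_real (A $ i $ j))"

definition adj :: "complex^'n^'m \<Rightarrow> complex^'m^'n" where
  "adj M = (\<chi> i j. cnj (M $ j $ i))"

definition eigenvalue :: "complex^'n^'n \<Rightarrow> complex \<Rightarrow> bool" where
  "eigenvalue M l \<longleftrightarrow> (\<exists>v. v \<noteq> 0 \<and> M *v v = l *s v)"

definition stable_matrix :: "real^'n^'n \<Rightarrow> bool" where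
  "stable_matrix A \<longleftrightarrow> (\<forall>l. eigenvalue (complex_matrix A) l \<longrightarrow> Re l < 0)"

definition singular_values :: "complex^'n^'m \<Rightarrow> real set" where
  "singular_values M = {s. 0 \<le> s \<and> eigenvalue (adj M ** M) (complex_of_real (s\<^sup>2))}"

definition max_singular_value :: "complex^'n^'m \<Rightarrow> real" where
  "max_singular_value M = Max (singular_values M)"

definition positive_semidefinite :: "complex^'n^'n \<Rightarrow> bool" where
  "positive_semidefinite M \<longleftrightarrow>
     adj M = M \<and> (\<forall>v. 0 \<le> Re (\<Sum>i\<in>UNIV. cnj (v $ i) * (M *v v) $ i))"

definition loewner_le :: "complex^'n^'n \<Rightarrow> complex^'n^'n \<Rightarrow> bool"  (infix "\<preceq>" 50) where
  "M \<preceq> N \<longleftrightarrow> positive_semidefinite (N - M)"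

text \<open>Block matrices are indexed by sum types; \<^term>\<open>Inl\<close> selects the upper/left block.
  Scalar multiples of the identity are written \<^term>\<open>mat c\<close>.\<close>

definition vstack :: "'a^'n^'p \<Rightarrow> 'a^'n^'q \<Rightarrow> 'a^'n^('p + 'q)" where
  "vstack M N = (\<chi> i. case i of Inl k \<Rightarrow> M $ k | Inr k \<Rightarrow> N $ k)"

definition hstack :: "'a^'p^'n \<Rightarrow> 'a^'q^'n \<Rightarrow> 'a^('p + 'q)^'n" where
  "hstack M N = (\<chi> i j. case j of Inl k \<Rightarrow> M $ i $ k | Inr k \<Rightarrow> N $ i $ k)"

definition block :: "'a^'r^'p \<Rightarrow> 'a^'s^'p \<Rightarrow> 'a^'r^'q \<Rightarrow> 'a^'s^'q \<Rightarrow> 'a^('r + 's)^('p + 'q)" where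
  "block M11 M12 M21 M22 = vstack (hstack M11 M12) (hstack M21 M22)"


section \<open>The inner program\<close>

text \<open>The inverse exists for \<open>\<delta> \<in> {-1<..1}\<close> when \<open>A\<close> is stable.\<close>

definition inner_matrix :: "real^'n^'n \<Rightarrow> real \<Rightarrow> real \<Rightarrow> complex^'n^'n" where
  "inner_matrix A \<omega> \<delta> =
     (if \<delta> = -1 then 0
      else matrix_inv (mat (\<i> * complex_of_real \<omega>)
             - complex_matrix (((1 - \<delta>) / (1 + \<delta>)) *\<^sub>R A - mat 1)))"

definition inner_objective :: "real^'n^'n \<Rightarrow> real \<Rightarrow> real \<Rightarrow> real" where
  "inner_objective A \<omega> \<delta> = max_singular_value (inner_matrix A \<omega> \<delta>)"


section \<open>The semidefinite program\<close>

definition transfer_P :: "real^'n^'n \<Rightarrow> complex \<Rightarrow> complex^('n + 'n)^('n + 'n)" where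
  "transfer_P A s =
     block (- mat 1) 0 0 0
     + vstack (- complex_matrix (sqrt 2 *\<^sub>R A)) (mat 1)
       ** matrix_inv (mat s - complex_matrix (A - mat 1))
       ** hstack (mat (complex_of_real (sqrt 2))) (mat 1)"

definition multiplier ::
  "complex^'n^'n \<Rightarrow> complex^'n^'n \<Rightarrow> real \<Rightarrow>
     complex^(('n + 'n) + ('n + 'n))^(('n + 'n) + ('n + 'n))" where
  "multiplier X Y \<gamma> =
     block (block X 0 0 (mat 1)) (block Y 0 0 0)
           (block (adj Y) 0 0 0) (block (- X) 0 0 (mat (- (complex_of_real \<gamma>)\<^sup>2)))"

definition sdp_lhs ::
  "real^'n^'n \<Rightarrow> real \<Rightarrow> complex^'n^'n \<Rightarrow> complex^'n^'n \<Rightarrow> real \<Rightarrow> complex^('n + 'n)^('n + 'n)" where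
  "sdp_lhs A \<omega> X Y \<gamma> =
     (let PI = vstack (transfer_P A (\<i> * complex_of_real \<omega>)) (mat 1)
      in adj PI ** multiplier X Y \<gamma> ** PI)"

text \<open>
  Two sign conditions are part of the program.
  The matrix inequality involves \<open>\<gamma>\<close> only through its square, so without \<open>0 \<le> \<gamma>\<close> the
  program is unbounded below.
  For \<open>w = \<delta> z\<close> the multiplier evaluates on the uncertainty channel to
  \<open>(1 - \<delta>\<^sup>2) z\<^sup>H X z\<close>, and bounding the gain for all \<open>\<bar>\<delta>\<bar> \<le> 1\<close> requires
  \<open>X\<close> to be positive semidefinite.  If \<open>X\<close> were merely Hermitian, then for invertible \<open>A\<close> and
  \<open>\<gamma>\<^sup>2 (1 + \<omega>\<^sup>2) > 1\<close> the matrices with \<open>X + Y = - \<gamma>\<^sup>2 (1 + j \<omega>) A\<^sup>-\<^sup>1\<close>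
  would make the left-hand side negative definite, however large the inner program's value is.
\<close>

definition sdp_feasible ::
  "real^'n^'n \<Rightarrow> real \<Rightarrow> real \<Rightarrow> ((complex^'n^'n) \<times> (complex^'n^'n) \<times> real) set" where
  "sdp_feasible A \<omega> \<epsilon> =
     {(X, Y, \<gamma>). adj X = X \<and> adj Y = - Y \<and> 0 \<preceq> X \<and> 0 \<le> \<gamma>
        \<and> sdp_lhs A \<omega> X Y \<gamma> \<preceq> mat (complex_of_real (- \<epsilon>))}"

text \<open>Extended reals make the value of an infeasible program \<open>\<infinity>\<close>.\<close>

definition sdp_value :: "real^'n^'n \<Rightarrow> real \<Rightarrow> real \<Rightarrow> ereal" where
  "sdp_value A \<omega> \<epsilon> = (INF (X, Y, \<gamma>) \<in> sdp_feasible A \<omega> \<epsilon>. ereal \<gamma>)"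

text \<open>The constraint is affine in \<open>X\<close>, \<open>Y\<close> and \<open>\<gamma>\<^sup>2\<close>; it is in these variables that the
  program is convex.\<close>

definition sdp_feasible_squared ::
  "real^'n^'n \<Rightarrow> real \<Rightarrow> real \<Rightarrow> ((complex^'n^'n) \<times> (complex^'n^'n) \<times> real) set" where
  "sdp_feasible_squared A \<omega> \<epsilon> = (\<lambda>(X, Y, \<gamma>). (X, Y, \<gamma>\<^sup>2)) ` sdp_feasible A \<omega> \<epsilon>"

end

theory Submission
  imports Defs "HOL-Computational_Algebra.Fundamental_Theorem_Algebra"
begin

text \<open>
  Put \<open>c = 1 + j \<omega>\<close>, \<open>\<kappa> = (1 - \<delta>) / (1 + \<delta>)\<close> and, with the state \<open>x\<close>, \<open>u = A x + sqrt 2 w\<^sub>\<delta>\<close>. The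
  constraint becomes \<open>2 Re \<langle>A x, (X - Y) u\<rangle> + |x|\<^sup>2 - \<gamma>\<^sup>2 |c x - u|\<^sup>2 < 0\<close>, where \<open>X - Y\<close> is an
  arbitrary matrix with positive semidefinite Hermitian part. Setting \<open>u = \<kappa> A x\<close> shows that every
  feasible \<open>\<gamma>\<close> bounds the inner program. Conversely, maximising over \<open>u\<close> shows that feasibility
  means finding one matrix \<open>T\<close> with \<open>|T x| < r |x|\<close>, \<open>r\<^sup>2 = |c|\<^sup>2 - \<gamma>\<^sup>-\<^sup>2\<close>, and
  \<open>Re \<langle>A x, T x - c x\<rangle> \<ge> 0\<close> for all \<open>x\<close>, whereas the bound on the inner program only says
  \<open>Re \<langle>A x, c x\<rangle> < r |A x| |x|\<close>, i.e. that each \<open>x\<close> has its own \<open>T\<close>.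

  If there were no common \<open>T\<close>, separation would give a positive semidefinite \<open>H\<close> with
  \<open>Re tr (H A\<^sup>H (T - c)) < 0\<close> for all \<open>T\<close> of norm at most \<open>r\<close>. Take \<open>T = r U\<close> with \<open>U\<close> the unitary polar
  factor of \<open>A H\<close>, so that \<open>B = U\<^sup>H A\<close> has \<open>B H\<close> positive semidefinite. Then \<open>H\<close> is a sum of matrices
  \<open>v v\<^sup>H\<close> with \<open>B v = k v\<close>, \<open>k \<ge> 0\<close>, and \<open>Re \<langle>A v, c v\<rangle> \<le> r |A v| |v| = r \<langle>v, B v\<rangle>\<close> for each of them
  contradicts the separation.
\<close>

section \<open>Complex matrices and the real inner product\<close>

lemma adj_adj [simp]: "adj (adj M) = M"
  by (simp add: adj_def vec_eq_iff)

lemma adj_mat [simp]: "adj (mat c) = mat (cnj c)"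
  by (simp add: adj_def mat_def vec_eq_iff)

lemma adj_zero [simp]: "adj 0 = 0"
  by (simp add: adj_def vec_eq_iff)

lemma adj_add: "adj (M + N) = adj M + adj N"
  by (simp add: adj_def vec_eq_iff)

lemma adj_diff: "adj (M - N) = adj M - adj N"
  by (simp add: adj_def vec_eq_iff)

lemma adj_uminus: "adj (- M) = - adj M"
  by (simp add: adj_def vec_eq_iff)

lemma adj_scaleR: "adj (a *\<^sub>R M) = a *\<^sub>R adj M"
  by (simp add: adj_def vec_eq_iff)

lemma adj_mult: "adj (M ** N) = adj N ** adj M"
  by (simp add: adj_def matrix_matrix_mult_def vec_eq_iff mult.commute)

lemma mat_mult_vec [simp]: "mat c *v x = c *s (x :: complex^'n)"
  by (simp add: mat_def matrix_vector_mult_def vec_eq_iff if_distrib if_distribR cong: if_cong)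

text \<open>The inner product \<bullet> on complex vectors is real-valued: it is the real part of
  this sesquilinear form. Quadratic forms are written with \<bullet>; \<open>hinner\<close> serves
  where a phase matters.\<close>

definition hinner :: "complex^'n \<Rightarrow> complex^'n \<Rightarrow> complex" where
  "hinner x y = (\<Sum>i\<in>UNIV. cnj (x $ i) * y $ i)"

lemma inner_complex_eq: "(x::complex) \<bullet> y = Re (cnj x * y)"
  by (simp add: inner_complex_def)

lemma Re_hinner: "Re (hinner x y) = x \<bullet> y"
  by (simp add: hinner_def inner_vec_def inner_complex_eq)

lemma Im_hinner: "Im (hinner x y) = (\<i> *s x) \<bullet> y"
  by (simp add: hinner_def inner_vec_def inner_complex_def algebra_simps)

lemma hinner_add_right: "hinner x (y + z) = hinner x y + hinner x z"
  by (simp add: hinner_def algebra_simps sum.distrib)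

lemma hinner_diff_right: "hinner x (y - z) = hinner x y - hinner x z"
  by (simp add: hinner_def algebra_simps sum_subtractf)

lemma hinner_scale_right: "hinner x (c *s y) = c * hinner x y"
  by (simp add: hinner_def sum_distrib_left algebra_simps)

lemma hinner_self: "hinner x x = of_real ((norm x)\<^sup>2)"
  by (simp add: complex_eq_iff Re_hinner Im_hinner power2_norm_eq_inner)
    (simp add: inner_vec_def inner_complex_def)

lemma hinner_commute: "hinner y x = cnj (hinner x y)"
  by (simp add: hinner_def mult.commute)

lemma norm_scale [simp]: "norm (c *s (x::complex^'n)) = norm c * norm x"
  by (simp add: norm_vec_def norm_mult L2_set_right_distrib)

lemma inner_matrix_vec: "x \<bullet> (M *v y) = (adj M *v x) \<bullet> (y :: complex^'n)"
proof -
  have "hinner x (M *v y) = (\<Sum>i\<in>UNIV. \<Sum>j\<in>UNIV. cnj (x $ i) * (M $ i $ j * y $ j))"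
    by (simp add: hinner_def matrix_vector_mult_def sum_distrib_left)
  also have "\<dots> = (\<Sum>j\<in>UNIV. \<Sum>i\<in>UNIV. cnj (x $ i) * (M $ i $ j * y $ j))"
    by (rule sum.swap)
  also have "\<dots> = hinner (adj M *v x) y"
    by (simp add: hinner_def matrix_vector_mult_def adj_def sum_distrib_left sum_distrib_right mult_ac)
  finally show ?thesis by (metis Re_hinner)
qed

lemma inner_scale_left: "(c *s x) \<bullet> y = x \<bullet> (cnj c *s (y :: complex^'n))"
  using inner_matrix_vec[of y "mat c" x] by (simp add: inner_commute)

lemma positive_semidefinite_iff:
  "positive_semidefinite M \<longleftrightarrow> adj M = M \<and> (\<forall>v. 0 \<le> v \<bullet> (M *v v))"
  by (simp add: positive_semidefinite_def flip: hinner_def Re_hinner)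

lemma of_real_scale [simp]: "of_real t *s (x :: complex^'n) = t *\<^sub>R x"
  unfolding vec_eq_iff vector_smult_component vector_scaleR_component
  by (simp add: scaleR_conv_of_real)

lemma matrix_mult_scaleR_right: "M ** (t *\<^sub>R N) = t *\<^sub>R (M ** (N :: complex^'n^'m))"
  by (simp add: matrix_matrix_mult_def vec_eq_iff scaleR_sum_right)

lemma matrix_mult_diff_right: "M ** (N - K) = M ** N - M ** (K :: complex^'n^'m)"
  by (simp add: matrix_matrix_mult_def vec_eq_iff right_diff_distrib sum_subtractf)

lemma matrix_vector_mult_scale: "M *v (c *s x) = c *s (M *v (x :: complex^'n))"
  by (metis vector_scalar_commute)

text \<open>The real inner product of matrices is the Frobenius one, a sum over columns, so
  \<open>inner_matrix_vec\<close> applies column by column.\<close>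

lemma inner_matrix_mult: "M \<bullet> (N ** K) = (adj N ** M) \<bullet> (K :: complex^'n^'m)"
proof -
  have col: "P \<bullet> Q = (\<Sum>j\<in>UNIV. column j P \<bullet> column j Q)" for P Q :: "complex^'n^'k"
    unfolding inner_vec_def column_def by (simp, rule sum.swap)
  have "column j (N ** K) = N *v column j K" "column j (adj N ** M) = adj N *v column j M" for j
    by (simp_all add: column_def matrix_matrix_mult_def matrix_vector_mult_def)
  then show ?thesis
    by (simp add: col inner_matrix_vec)
qed

section \<open>Rank-one matrices and Hermitian forms\<close>

definition outer :: "complex^'n \<Rightarrow> complex^'n^'n" where
  "outer v = (\<chi> i j. v $ i * cnj (v $ j))"

lemma outer_mult_vec: "outer v *v x = hinner v x *s v"
  by (simp add: outer_def matrix_vector_mult_def hinner_def vec_eq_iff sum_distrib_left mult_ac)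

lemma adj_outer [simp]: "adj (outer v) = outer v"
  by (simp add: adj_def outer_def vec_eq_iff)

lemma inner_outer: "outer v \<bullet> M = v \<bullet> (M *v v)"
proof -
  have "v \<bullet> (M *v v) = (\<Sum>i\<in>UNIV. \<Sum>j\<in>UNIV. v $ i \<bullet> (M $ i $ j * v $ j))"
    by (simp add: inner_vec_def matrix_vector_mult_def inner_sum_right)
  also have "\<dots> = outer v \<bullet> M"
    by (simp add: inner_vec_def outer_def inner_complex_def algebra_simps)
  finally show ?thesis by simp
qed

lemma outer_form: "x \<bullet> (outer v *v x) = (norm (hinner v x))\<^sup>2"
proof -
  have "hinner x (outer v *v x) = of_real ((norm (hinner v x))\<^sup>2)"
    by (simp add: outer_mult_vec hinner_scale_right hinner_commute[of x v] complex_norm_square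
        flip: of_real_power)
  then show ?thesis by (metis Re_hinner Re_complex_of_real)
qed

text \<open>By \<open>Im_hinner\<close> the left-hand side is the imaginary part of
  \<open>x^H M x\<close>, and a Hermitian form is real.\<close>

lemma self_adjoint_Im_form:
  assumes "adj M = M" shows "(\<i> *s x) \<bullet> (M *v x) = 0"
proof -
  have "(\<i> *s x) \<bullet> (M *v x) = (M *v (\<i> *s x)) \<bullet> x"
    by (simp add: inner_matrix_vec assms)
  also have "\<dots> = - (M *v x) \<bullet> (\<i> *s x)"
    by (simp add: matrix_vector_mult_scale inner_scale_left)
  finally show ?thesis by (simp add: inner_commute)
qed

text \<open>Polarisation: the cross terms of the form at a sum of two vectors cancel, and they
  determine the matrix.\<close>

lemma self_adjointI:
  assumes "\<And>x. (\<i> *s x) \<bullet> (M *v x) = 0"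
  shows "adj M = M"
proof -
  have sym: "x \<bullet> ((adj M - M) *v y) = 0" for x y
  proof -
    \<comment> \<open>The factor turns the vanishing imaginary cross terms into an identity between
      real inner products with \<open>x\<close> itself.\<close>
    let ?z = "- \<i> *s x"
    have x: "\<i> *s ?z = x"
      by (simp add: vec_eq_iff)
    have "(\<i> *s (?z + y)) \<bullet> (M *v (?z + y)) = 0" by (rule assms)
    then have "(\<i> *s ?z) \<bullet> (M *v y) + (\<i> *s y) \<bullet> (M *v ?z) = 0"
      using assms[of "?z"] assms[of y]
      by (simp only: matrix_vector_right_distrib vector_add_ldistrib inner_add_left inner_add_right)
    moreover have "(\<i> *s y) \<bullet> (M *v ?z) = y \<bullet> (- \<i> *s (M *v (- \<i> *s x)))"
      by (simp only: inner_scale_left) simp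
    moreover have "- \<i> *s (M *v (- \<i> *s x)) = - (M *v x)"
      by (simp only: matrix_vector_mult_scale) (simp add: vec_eq_iff)
    ultimately have "x \<bullet> (M *v y) = y \<bullet> (M *v x)"
      unfolding x by simp
    then show ?thesis
      by (simp add: matrix_vector_mult_diff_rdistrib inner_diff_right inner_matrix_vec[of x "adj M"] inner_commute)
  qed
  have "(adj M - M) *v y = 0 *v y" for y
    using sym[of "(adj M - M) *v y" y] by simp
  then have "adj M - M = 0" by (metis matrix_eq)
  then show ?thesis by simp
qed

lemma matrix_vector_mult_scaleR_right [simp]: "M *v (t *\<^sub>R x) = t *\<^sub>R (M *v (x :: complex^'n))"
  by (simp add: matrix_vector_mult_def vec_eq_iff scaleR_sum_right)

lemma matrix_vector_mult_scaleR_left [simp]: "(t *\<^sub>R M) *v x = t *\<^sub>R (M *v (x :: complex^'n))"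
  by (simp add: matrix_vector_mult_def vec_eq_iff scaleR_sum_right)

lemma minus_matrix_vec: "(- M) *v x = - (M *v (x :: complex^'n))"
  using matrix_vector_mult_scaleR_left[of "-1" M x] by simp

lemma bounded_linear_matrix_vec: "bounded_linear (\<lambda>x. M *v (x :: complex^'n))"
  unfolding linear_conv_bounded_linear[symmetric]
  by (rule linearI) (simp_all add: matrix_vector_right_distrib)

lemma continuous_on_matrix_vector_right [continuous_intros]:
  "continuous_on S f \<Longrightarrow> continuous_on S (\<lambda>s. M *v (f s :: complex^'n))"
  by (rule bounded_linear.continuous_on[OF bounded_linear_matrix_vec])

section \<open>Simultaneous rank-one decomposition\<close>

text \<open>Moving from \<open>y\<close> in the direction \<open>M y\<close> changes the form to
  first order by a multiple of \<open>|M y|^2\<close>; a nonnegative form has no nonzero slope at a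
  zero.\<close>

lemma positive_semidefinite_kernel:
  assumes "positive_semidefinite M" "y \<bullet> (M *v y) = 0"
  shows "M *v y = 0"
proof -
  have sa: "adj M = M" and pos: "\<And>v. 0 \<le> v \<bullet> (M *v v)"
    using assms(1) by (auto simp: positive_semidefinite_iff)
  define z where "z = M *v y"
  have "0 \<le> t * (2 * (norm z)\<^sup>2) + t\<^sup>2 * (z \<bullet> (M *v z))" for t
  proof -
    have "y \<bullet> (M *v z) = (norm z)\<^sup>2"
      by (simp add: inner_matrix_vec sa z_def power2_norm_eq_inner)
    moreover have "z \<bullet> (M *v y) = (norm z)\<^sup>2"
      by (simp add: z_def power2_norm_eq_inner)
    moreover have "0 \<le> (y + t *\<^sub>R z) \<bullet> (M *v (y + t *\<^sub>R z))" by (rule pos)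
    ultimately show ?thesis
      using assms(2)
      by (simp add: matrix_vector_right_distrib inner_add_left
          inner_add_right power2_eq_square algebra_simps)
  qed
  note quad = this
  define b where "b = z \<bullet> (M *v z)"
  have "b \<ge> 0" using pos b_def by simp
  \<comment> \<open>The exact minimiser would divide by \<open>b\<close>, which may vanish. The
    summand 1 avoids this, and the step \<open>- a * s\<close> still makes the quadratic negative
    unless \<open>a = 0\<close>.\<close>
  define s where "s = 1 / (b + 1)"
  have s: "s > 0" "s * b = 1 - s" using \<open>b \<ge> 0\<close> by (auto simp: s_def field_simps)
  define a where "a = (norm z)\<^sup>2"
  have "0 \<le> (- a * s) * (2 * a) + (- a * s)\<^sup>2 * b"
    using quad b_def a_def by blast
  also have "\<dots> = a\<^sup>2 * s * (s * b - 2)"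
    by (simp add: power2_eq_square algebra_simps)
  also have "\<dots> = - (a\<^sup>2 * (s * (1 + s)))"
    unfolding s(2) by (simp add: algebra_simps)
  finally have "a\<^sup>2 * (s * (1 + s)) \<le> 0" by simp
  moreover have "s * (1 + s) > 0" using s(1) by simp
  ultimately have "a = 0"
    by (metis less_le_not_le mult_pos_pos zero_less_power2)
  then have "z = 0" by (simp add: a_def)
  then show ?thesis by (simp add: z_def)
qed

text \<open>The difference annihilates \<open>y\<close>, so \<open>x\<close> may be replaced by
  \<open>x - hinner v x *s y\<close>, which is orthogonal to \<open>v\<close>; on such vectors the
  difference acts as \<open>M\<close>.\<close>

lemma positive_semidefinite_peel:
  assumes "positive_semidefinite M" "M *v y = k *\<^sub>R v" "hinner v y = 1"
  shows "positive_semidefinite (M - k *\<^sub>R outer v)"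
proof -
  define N where "N = M - k *\<^sub>R outer v"
  have sa: "adj M = M" and pos: "\<And>v. 0 \<le> v \<bullet> (M *v v)"
    using assms(1) by (auto simp: positive_semidefinite_iff)
  have saN: "adj N = N" by (simp add: N_def adj_diff adj_scaleR sa)
  have Nv: "N *v x = M *v x - k *\<^sub>R (hinner v x *s v)" for x
    by (simp add: N_def matrix_vector_mult_diff_rdistrib  outer_mult_vec)
  have Ny: "N *v y = 0" by (simp add: Nv assms)
  have "0 \<le> x \<bullet> (N *v x)" for x
  proof -
    define x' where "x' = x - hinner v x *s y"
    have Nx: "N *v x = N *v x'"
      by (simp add: x'_def matrix_vector_mult_diff_distrib matrix_vector_mult_scale Ny)
    have "x \<bullet> (N *v x) = (N *v x) \<bullet> x'"
      by (metis Nx inner_matrix_vec saN)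
    also have "\<dots> = (N *v x') \<bullet> x'" by (simp add: Nx)
    also have "hinner v x' = 0"
      by (simp add: x'_def hinner_diff_right hinner_scale_right assms)
    then have "N *v x' = M *v x'" by (simp add: Nv)
    finally show ?thesis using pos by (simp add: inner_commute)
  qed
  then show ?thesis
    unfolding N_def[symmetric] positive_semidefinite_iff using saN by simp
qed

section \<open>Polynomials in a matrix applied to a vector, and eigenvectors\<close>

definition poly_act :: "complex^'n^'n \<Rightarrow> complex poly \<Rightarrow> complex^'n \<Rightarrow> complex^'n" where
  "poly_act B p w = fold_coeffs (\<lambda>a x. a *s w + B *v x) p 0"

lemma poly_act_0 [simp]: "poly_act B 0 w = 0"
  by (simp add: poly_act_def)

lemma poly_act_pCons [simp]: "poly_act B (pCons a p) w = a *s w + B *v poly_act B p w"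
  by (cases "p = 0 \<and> a = 0") (auto simp: poly_act_def)

lemma poly_act_add: "poly_act B (p + q) w = poly_act B p w + poly_act B q w"
proof (induction p q rule: poly_induct2)
  case (pCons a p b q)
  then show ?case
    by (simp add: matrix_vector_right_distrib vector_sadd_rdistrib)
qed simp

lemma poly_act_smult: "poly_act B (smult c p) w = c *s poly_act B p w"
proof (induction p)
  case (pCons a p)
  then show ?case
    by (simp add: matrix_vector_mult_scale vector_add_ldistrib)
qed simp

lemma poly_act_linear_factor:
  "poly_act B ([:- k, 1:] * p) w = B *v poly_act B p w - k *s poly_act B p w"
  proof -
  have "[:- k, 1:] * p = smult (- k) p + pCons 0 p" by simp
  then show ?thesis
    by (simp only: poly_act_add poly_act_smult poly_act_pCons) (simp add: vec_eq_iff)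
qed

lemma poly_act_sum: "finite S \<Longrightarrow> poly_act B (sum f S) w = (\<Sum>i\<in>S. poly_act B (f i) w)"
  by (induction S rule: finite_induct) (simp_all add: poly_act_add)

text \<open>The iterates \<open>w\<close>, \<open>B w\<close>, \<open>B^2 w\<close>, ... live in a
  finite-dimensional space: either two coincide, or they form an infinite and hence dependent
  set.\<close>

lemma annihilating_polynomial:
  fixes B :: "complex^'n^'n"
  shows "\<exists>p. p \<noteq> 0 \<and> poly_act B p w = 0"
proof (cases "inj (\<lambda>i. poly_act B (monom 1 i) w)")
  case False
  then obtain i j :: nat where ij: "i \<noteq> j" "poly_act B (monom 1 i) w = poly_act B (monom 1 j) w"
    by (auto simp: inj_def)
  have "poly_act B (monom 1 i + smult (-1) (monom 1 j)) w = 0"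
    unfolding poly_act_add poly_act_smult ij by simp
  moreover have "coeff (monom (1::complex) i + smult (-1) (monom 1 j)) i = 1"
    using ij by simp
  then have "monom (1::complex) i + smult (-1) (monom 1 j) \<noteq> 0" by (metis coeff_0 zero_neq_one)
  ultimately show ?thesis by blast
next
  case True
  let ?f = "\<lambda>i. poly_act B (monom 1 i) w"
  have "infinite (range ?f)" using True by (simp add: finite_image_iff)
  then have "dependent (range ?f)"
    using independent_imp_finite by blast
  then obtain S u where S: "finite S" "S \<subseteq> range ?f" "(\<Sum>v\<in>S. u v *\<^sub>R v) = 0" "\<exists>v\<in>S. u v \<noteq> 0"
    unfolding dependent_explicit by blast
  obtain T where T: "S = ?f ` T" using S(2) by (metis subset_imageE)
  have injT: "inj_on ?f T" using True inj_on_subset by blast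
  have finT: "finite T" using S(1) T injT finite_image_iff by blast
  \<comment> \<open>Dependence is over the reals, so the real coefficients are embedded in the
    complex numbers.\<close>
  define p :: "complex poly" where "p = (\<Sum>i\<in>T. smult (of_real (u (?f i))) (monom 1 i))"
  have "poly_act B p w = (\<Sum>i\<in>T. u (?f i) *\<^sub>R ?f i)"
    unfolding p_def poly_act_sum[OF finT] poly_act_smult
    by simp
  also have "\<dots> = 0" using S(3) unfolding T sum.reindex[OF injT] by simp
  finally have "poly_act B p w = 0" .
  moreover obtain i where "i \<in> T" "u (?f i) \<noteq> 0" using S(4) T by blast
  then have "coeff p i \<noteq> 0"
    using finT by (simp add: p_def coeff_sum if_distrib cong: if_cong)
  then have "p \<noteq> 0" by force
  ultimately show ?thesis by blast
qed

text \<open>Take \<open>p\<close> of least degree with \<open>p(B) H x = 0\<close> and a root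
  \<open>k\<close> of it. The cofactor applied to \<open>H x\<close> is nonzero by minimality, is an
  eigenvector for \<open>k\<close>, and stays in the range of \<open>H\<close>, which is invariant
  under \<open>B\<close>.\<close>

lemma range_eigenvector:
  fixes B H :: "complex^'n^'n"
  assumes "H \<noteq> 0" and inv: "\<And>x. \<exists>y. B *v (H *v x) = H *v y"
  shows "\<exists>y k. H *v y \<noteq> 0 \<and> B *v (H *v y) = k *s (H *v y)"
proof -
  obtain x where x: "H *v x \<noteq> 0"
    using assms(1) by (metis matrix_eq matrix_vector_mult_0)
  let ?P = "\<lambda>p :: complex poly. p \<noteq> 0 \<and> poly_act B p (H *v x) = 0"
  obtain p where p: "?P p" and min: "\<And>q. ?P q \<Longrightarrow> degree p \<le> degree q"
    using annihilating_polynomial[of B "H *v x"] ex_has_least_nat[of ?P _ degree] by blast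
  have "degree p \<noteq> 0"
  proof
    assume "degree p = 0"
    then obtain a where "p = [:a:]" by (rule degree_eq_zeroE)
    then show False using p x by simp
  qed
  then obtain k where "poly p k = 0"
    using fundamental_theorem_of_algebra[of p] by (auto simp: constant_degree)
  then obtain q where q: "p = [:- k, 1:] * q"
    by (metis dvd_def poly_eq_0_iff_dvd)
  have "q \<noteq> 0" using p q by auto
  then have "degree p = Suc (degree q)" unfolding q by (subst degree_mult_eq) auto
  then have nz: "poly_act B q (H *v x) \<noteq> 0" using min[of q] \<open>q \<noteq> 0\<close> by auto
  have "\<exists>y. poly_act B r (H *v x) = H *v y" for r
  proof (induction r)
    case 0
    show ?case by (metis matrix_vector_mult_0_right poly_act_0)
  next
    case (pCons a r)
    then obtain y z where "poly_act B r (H *v x) = H *v y" "B *v (H *v y) = H *v z"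
      using inv by blast
    then have "poly_act B (pCons a r) (H *v x) = H *v (a *s x + z)"
      by (simp add: matrix_vector_right_distrib matrix_vector_mult_scale)
    then show ?case by blast
  qed
  then obtain y where "poly_act B q (H *v x) = H *v y" by blast
  moreover have "B *v poly_act B q (H *v x) = k *s poly_act B q (H *v x)"
    using p unfolding q poly_act_linear_factor by auto
  ultimately show ?thesis using nz by auto
qed

text \<open>Splitting off \<open>outer v\<close> for an eigenvector \<open>v\<close> of \<open>B\<close> in the range of \<open>H\<close> preserves
  both semidefiniteness hypotheses and enlarges the kernel of \<open>H\<close>.\<close>

lemma positive_semidefinite_pair_induct:
  fixes B H :: "complex^'n^'n" and \<phi> :: "complex^'n^'n \<Rightarrow> real"
  assumes "positive_semidefinite H" "positive_semidefinite (B ** H)"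
    and lin: "linear \<phi>"
    and rank_one: "\<And>v k. 0 \<le> k \<Longrightarrow> B *v v = k *\<^sub>R v \<Longrightarrow> \<phi> (outer v) \<le> 0"
  shows "\<phi> H \<le> 0"
  using assms(1,2)
\<comment> \<open>The induction is on the real rank of \<open>H\<close>.\<close>
proof (induction "DIM(complex^'n) - dim {x. H *v x = 0}" arbitrary: H rule: less_induct)
  case less
  have sa: "adj H = H" and pos: "\<And>v. 0 \<le> v \<bullet> (H *v v)"
    using less.prems by (auto simp: positive_semidefinite_iff)
  have saG: "adj (B ** H) = B ** H" and posG: "\<And>v. 0 \<le> v \<bullet> (B *v (H *v v))"
    using less.prems by (auto simp: positive_semidefinite_iff matrix_vector_mul_assoc)
  show ?case
  proof (cases "H = 0")
    case True
    then show ?thesis using lin by (simp add: linear_0)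
  next
    case False
    \<comment> \<open>Since \<open>B ** H\<close> is Hermitian, \<open>B H = H B^H\<close>, so
      \<open>B\<close> maps the range of \<open>H\<close> into itself.\<close>
    have "B *v (H *v x) = H *v (adj B *v x)" for x
      using saG by (simp add: adj_mult sa matrix_vector_mul_assoc)
    then obtain y0 k where y0: "H *v y0 \<noteq> 0" "B *v (H *v y0) = k *s (H *v y0)"
      using range_eigenvector[OF False] by metis
    have "y0 \<bullet> (H *v y0) > 0"
      using pos[of y0] positive_semidefinite_kernel[OF less.prems(1)] y0(1) by force
    \<comment> \<open>Scaled so that \<open>y^H H y = 1\<close>, the normalisation under which
      \<open>outer v\<close> with \<open>v = H y\<close> can be split off.\<close>
    define y where "y = (1 / sqrt (y0 \<bullet> (H *v y0))) *\<^sub>R y0"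
    define v where "v = H *v y"
    have yv1: "y \<bullet> v = 1"
      using \<open>y0 \<bullet> (H *v y0) > 0\<close>
      by (simp add: v_def y_def field_simps flip: power2_eq_square)
    have Bv: "B *v v = k *s v"
      by (simp add: v_def y_def y0) (simp add: vec_eq_iff)
    have iyv: "(\<i> *s y) \<bullet> v = 0"
      unfolding v_def by (rule self_adjoint_Im_form[OF sa])
    have hyv: "hinner y v = 1"
      by (simp add: complex_eq_iff Re_hinner Im_hinner yv1 iyv)
    then have hvy: "hinner v y = 1"
      by (simp add: hinner_commute[of v])
    \<comment> \<open>The eigenvalue is the value at \<open>y\<close> of the semidefinite form of
      \<open>B ** H\<close>, hence real and nonnegative.\<close>
    have "hinner y (B *v v) = k"
      unfolding Bv by (simp add: hinner_scale_right hyv)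
    moreover have "(\<i> *s y) \<bullet> (B *v v) = 0"
      using self_adjoint_Im_form[OF saG, of y] by (simp add: v_def matrix_vector_mul_assoc)
    moreover have "0 \<le> y \<bullet> (B *v v)" using posG by (simp add: v_def)
    ultimately have k: "Im k = 0" "0 \<le> Re k"
      by (metis Im_hinner, metis Re_hinner)
    then have Bv': "B *v v = Re k *\<^sub>R v"
      unfolding Bv by (simp add: vec_eq_iff complex_eq_iff)
    have vnz: "v \<noteq> 0" using yv1 by auto
    define H' where "H' = H - outer v"
    have psd: "positive_semidefinite H'"
      using positive_semidefinite_peel[OF less.prems(1), of y 1 v] hvy by (simp add: H'_def v_def)
    have "B ** outer v = Re k *\<^sub>R outer v"
    proof -
      have "(B ** outer v) *v x = (Re k *\<^sub>R outer v) *v x" for x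
        by (simp add: outer_mult_vec matrix_vector_mult_scale Bv' 
            flip: matrix_vector_mul_assoc) (simp add: vec_eq_iff)
      then show ?thesis by (metis matrix_eq)
    qed
    then have BH': "B ** H' = B ** H - Re k *\<^sub>R outer v"
      by (simp add: H'_def matrix_mult_diff_right)
    have "(B ** H) *v y = Re k *\<^sub>R v"
      using Bv' by (simp add: v_def matrix_vector_mul_assoc)
    then have psdG: "positive_semidefinite (B ** H')"
      unfolding BH' using positive_semidefinite_peel[OF less.prems(2) _ hvy] by blast
    have H'v: "H' *v x = H *v x - hinner v x *s v" for x
      by (simp add: H'_def matrix_vector_mult_diff_rdistrib outer_mult_vec)
    \<comment> \<open>The kernel of \<open>H\<close> is orthogonal to \<open>v = H y\<close>, so it
      survives; \<open>y\<close> itself joins it, which makes the rank drop.\<close>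
    have ker: "H' *v x = 0" if "H *v x = 0" for x
    proof -
      have "v \<bullet> z = 0" if "H *v z = 0" for z
        by (metis inner_zero_right inner_matrix_vec sa that v_def)
      moreover have "H *v (\<i> *s x) = 0"
        using that by (simp only: matrix_vector_mult_scale) simp
      ultimately have "hinner v x = 0"
        using that inner_scale_left[of \<i> v x] by (simp add: complex_eq_iff Re_hinner Im_hinner)
      then show ?thesis by (simp add: H'v that)
    qed
    have sub: "subspace {x. M *v x = 0}" for M :: "complex^'n^'n"
      by (simp add: subspace_def matrix_vector_right_distrib)
    have "y \<in> {x. H' *v x = 0} - {x. H *v x = 0}"
      using vnz by (simp add: H'v hvy flip: v_def)
    then have "{x. H *v x = 0} \<subset> {x. H' *v x = 0}"
      using ker by blast
    then have "dim {x. H *v x = 0} < dim {x. H' *v x = 0}"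
      by (intro dim_psubset) (simp add: span_eq_iff[THEN iffD2, OF sub])
    moreover have "dim {x. H' *v x = 0} \<le> DIM(complex^'n)"
      by (rule dim_subset_UNIV)
    ultimately have "\<phi> H' \<le> 0"
      by (intro less.hyps psd psdG) linarith
    moreover have "\<phi> H = \<phi> H' + \<phi> (outer v)"
      using linear_add[OF lin, of H' "outer v"] by (simp add: H'_def)
    ultimately show ?thesis using rank_one[OF k(2) Bv'] by simp
  qed
qed

section \<open>Polar decomposition and separation\<close>

lemma norm_matrix_entry_le:
  fixes T :: "complex^'n^'m"
  assumes "\<And>x. norm (T *v x) \<le> r * norm x"
  shows "norm (T $ i $ j) \<le> r"
proof -
  have "norm (T $ i $ j) = norm ((T *v axis j 1) $ i)"
    by (simp add: matrix_vector_mul_component axis_def inner_vec_def matrix_vector_mult_def if_distrib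
        cong: if_cong)
  also have "\<dots> \<le> norm (T *v axis j 1)" by (rule Finite_Cartesian_Product.norm_nth_le)
  also have "\<dots> \<le> r" using assms[of "axis j 1"] by simp
  finally show ?thesis .
qed

lemma bounded_operator_ball:
  "bounded {T :: complex^'n^'m. \<forall>x. norm (T *v x) \<le> r * norm x}"
proof -
  have "norm T \<le> (\<Sum>i\<in>(UNIV::'m set). \<Sum>j\<in>(UNIV::'n set). r)"
    if "\<forall>x. norm (T *v x) \<le> r * norm x" for T :: "complex^'n^'m"
  proof -
    have "norm T \<le> (\<Sum>i\<in>UNIV. norm (T $ i))"
      by (simp add: norm_vec_def L2_set_le_sum)
    also have "\<dots> \<le> (\<Sum>i\<in>UNIV. \<Sum>j\<in>UNIV. norm (T $ i $ j))"
      by (intro sum_mono) (simp add: norm_vec_def[of "_ $ _"] L2_set_le_sum)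
    also have "\<dots> \<le> (\<Sum>i\<in>(UNIV::'m set). \<Sum>j\<in>(UNIV::'n set). r)"
      using that by (intro sum_mono norm_matrix_entry_le) auto
    finally show ?thesis .
  qed
  then show ?thesis by (auto simp: bounded_iff)
qed

lemma linear_matrix_vector_left: "linear (\<lambda>T. T *v (x :: complex^'n))"
  by (rule linearI) (simp_all add: matrix_vector_mult_add_rdistrib)

lemma continuous_on_matrix_vector_left [continuous_intros]:
  "continuous_on S (\<lambda>T. T *v (x :: complex^'n))"
  using linear_matrix_vector_left by (rule linear_continuous_on[OF linear_conv_bounded_linear[THEN iffD1]])

lemma compact_operator_ball:
  "compact {T :: complex^'n^'m. \<forall>x. norm (T *v x) \<le> r * norm x}"
proof -
  have "closed {T :: complex^'n^'m. \<forall>x. norm (T *v x) \<le> r * norm x}"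
    by (intro closed_Collect_all closed_Collect_le continuous_intros)
  then show ?thesis using bounded_operator_ball compact_eq_bounded_closed by blast
qed

lemma unitary_norm:
  assumes "adj U ** U = mat 1"
  shows "norm (U *v x) = norm (x :: complex^'n)"
proof -
  have "(U *v x) \<bullet> (U *v x) = (adj U *v (U *v x)) \<bullet> x"
    by (simp only: inner_matrix_vec)
  also have "\<dots> = x \<bullet> x" by (simp add: matrix_vector_mul_assoc assms)
  finally show ?thesis by (simp add: norm_eq_sqrt_inner)
qed

lemma compact_unitary: "compact {U :: complex^'n^'n. adj U ** U = mat 1}"
proof -
  have "{U :: complex^'n^'n. adj U ** U = mat 1}
      \<subseteq> {T. \<forall>x. norm (T *v x) \<le> 1 * norm x}"
    using unitary_norm by fastforce
  then have "bounded {U :: complex^'n^'n. adj U ** U = mat 1}"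
    using bounded_operator_ball bounded_subset by blast
  moreover have "closed {U :: complex^'n^'n. adj U ** U = mat 1}"
  proof -
    have "closed {U :: complex^'n^'n. \<forall>x. adj U *v (U *v x) = x}"
    proof (intro closed_Collect_all closed_Collect_eq continuous_intros)
      fix x :: "complex^'n"
      have "continuous_on UNIV (\<lambda>U. adj U *v (U *v x))"
        unfolding matrix_vector_mult_def adj_def by (intro continuous_intros)
      then show "continuous_on UNIV (\<lambda>U. adj U *v (U *v x))" .
    qed
    moreover have "adj U ** U = mat 1 \<longleftrightarrow> (\<forall>x. adj U *v (U *v x) = x)" for U :: "complex^'n^'n"
      by (metis matrix_eq matrix_vector_mul_assoc matrix_vector_mul_lid)
    ultimately show ?thesis by simp
  qed
  ultimately show ?thesis using compact_eq_bounded_closed by blast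
qed

text \<open>For a unit vector \<open>e\<close>, this multiplies \<open>e\<close> by \<open>z\<close>
  and fixes its orthogonal complement.\<close>

definition phase :: "complex \<Rightarrow> complex^'n \<Rightarrow> complex^'n^'n" where
  "phase z e = mat 1 + mat (z - 1) ** outer e"

lemma phase_mult_vec: "phase z e *v x = x + ((z - 1) * hinner e x) *s e"
  by (simp add: phase_def matrix_vector_mult_add_rdistrib outer_mult_vec flip: matrix_vector_mul_assoc)

lemma adj_phase: "adj (phase z e) = phase (cnj z) e"
proof -
  have "outer e ** mat k = mat k ** outer e" for k
  proof -
    have "(outer e ** mat k) *v x = (mat k ** outer e) *v x" for x
      by (simp add: matrix_vector_mult_scale flip: matrix_vector_mul_assoc)
    then show ?thesis by (metis matrix_eq)
  qed
  then show ?thesis by (simp add: phase_def adj_add adj_mult)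
qed

lemma unitary_phase:
  assumes "norm e = 1" "norm z = 1"
  shows "adj (phase z e) ** phase z e = mat 1"
proof -
  have z: "cnj z * z = 1"
    using assms(2) complex_norm_square[of z] by (simp add: mult.commute)
  have e: "hinner e e = 1" using assms(1) by (simp add: hinner_self)
  have "(adj (phase z e) ** phase z e) *v x = mat 1 *v x" for x
  proof -
    have "(adj (phase z e) ** phase z e) *v x =
        x + ((z - 1) * hinner e x + (cnj z - 1) * (hinner e x + (z - 1) * hinner e x)) *s e"
      by (simp add: adj_phase phase_mult_vec hinner_add_right hinner_scale_right e vector_sadd_rdistrib
          flip: matrix_vector_mul_assoc)
    also have "(z - 1) * hinner e x + (cnj z - 1) * (hinner e x + (z - 1) * hinner e x)
        = (cnj z * z - 1) * hinner e x"
      by (simp add: algebra_simps)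
    finally show ?thesis by (simp add: z)
  qed
  then show ?thesis by (metis matrix_eq)
qed

text \<open>The polar factor is found as a maximiser of \<open>U \<mapsto> M \<bullet> U\<close> over the unitary group: multiplying
  it by unitaries that change the phase of a single vector cannot increase the value.\<close>

lemma polar_decomposition:
  fixes M :: "complex^'n^'n"
  shows "\<exists>U. adj U ** U = mat 1 \<and> positive_semidefinite (adj U ** M)"
proof -
  let ?\<U> = "{U :: complex^'n^'n. adj U ** U = mat 1}"
  have "mat 1 \<in> ?\<U>" by simp
  then have "?\<U> \<noteq> {}" by blast
  moreover have "continuous_on ?\<U> (\<lambda>U. M \<bullet> U)" by (intro continuous_intros)
  ultimately obtain U where U: "U \<in> ?\<U>" and max: "\<And>V. V \<in> ?\<U> \<Longrightarrow> M \<bullet> V \<le> M \<bullet> U"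
    using continuous_attains_sup[OF compact_unitary, of "\<lambda>U. M \<bullet> U"] by blast
  define G where "G = adj U ** M"
  \<comment> \<open>Replacing \<open>U\<close> by \<open>U ** phase z e\<close> stays in the unitary
    group and changes the maximised value by exactly this form.\<close>
  have phase_le: "(z *s e - e) \<bullet> (G *v e) \<le> 0" if "norm e = 1" "norm z = 1" for z e
  proof -
    have "adj (U ** phase z e) ** (U ** phase z e) = adj (phase z e) ** (adj U ** U) ** phase z e"
      by (simp add: adj_mult matrix_mul_assoc)
    also have "\<dots> = mat 1"
      using U unitary_phase[OF that] by simp
    finally have "M \<bullet> (U ** phase z e) \<le> M \<bullet> (U ** mat 1)"
      using max by simp
    then have "G \<bullet> phase z e \<le> G \<bullet> mat 1"
      by (simp only: inner_matrix_mult G_def)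
    then have "G \<bullet> (mat (z - 1) ** outer e) \<le> 0"
      by (simp add: phase_def inner_add_right)
    also have "G \<bullet> (mat (z - 1) ** outer e) = e \<bullet> (mat (cnj (z - 1)) *v (G *v e))"
      by (subst inner_matrix_mult)
        (simp add: inner_commute[of _ "outer e"] inner_outer flip: matrix_vector_mul_assoc)
    also have "\<dots> = ((z - 1) *s e) \<bullet> (G *v e)"
      by (simp only: inner_scale_left mat_mult_vec)
    also have "(z - 1) *s e = z *s e - e"
      by (simp add: vector_sub_rdistrib)
    finally show ?thesis .
  qed
  have form: "0 \<le> e \<bullet> (G *v e) \<and> (\<i> *s e) \<bullet> (G *v e) = 0" if "norm e = 1" for e
  proof -
    define g where "g = hinner e (G *v e)"
    have le: "Re (cnj z * g) \<le> Re g" if "norm z = 1" for z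
    proof -
      have "Re (cnj z * g) = (z *s e) \<bullet> (G *v e)"
        by (simp only: g_def inner_scale_left Re_hinner flip: hinner_scale_right)
      then show ?thesis using phase_le[OF \<open>norm e = 1\<close> that]
        by (simp add: inner_diff_left g_def Re_hinner)
    qed
    \<comment> \<open>With \<open>z\<close> the phase of \<open>g\<close>, the left side of
      \<open>le\<close> is \<open>norm g\<close>; and \<open>norm g \<le> Re g\<close> leaves only
      real nonnegative \<open>g\<close>.\<close>
    have "norm g \<le> Re g"
    proof (cases "g = 0")
      case False
      have "cnj (sgn g) * g = of_real (norm g)"
        using False complex_norm_square[of g]
        by (simp add: sgn_div_norm scaleR_conv_of_real field_simps power2_eq_square)
      then show ?thesis using le[of "sgn g"] False by (simp add: norm_sgn)
    qed simp
    then have "0 \<le> Re g" by (meson norm_ge_zero order_trans)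
    moreover have "(norm g)\<^sup>2 \<le> (Re g)\<^sup>2"
      using \<open>norm g \<le> Re g\<close> by (intro power_mono) simp_all
    then have "Im g = 0" by (simp add: cmod_power2)
    ultimately have "Im g = 0 \<and> 0 \<le> Re g" by blast
    then show ?thesis by (metis g_def Re_hinner Im_hinner)
  qed
  have "0 \<le> x \<bullet> (G *v x) \<and> (\<i> *s x) \<bullet> (G *v x) = 0" for x
  proof (cases "x = 0")
    case False
    define e where "e = (1 / norm x) *\<^sub>R x"
    have x: "x = norm x *\<^sub>R e" and e: "norm e = 1"
      using False by (simp_all add: e_def)
    have ix: "\<i> *s x = norm x *\<^sub>R (\<i> *s e)"
      by (subst x) (simp add: vec_eq_iff)
    have "x \<bullet> (G *v x) = (norm x)\<^sup>2 * (e \<bullet> (G *v e))"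
      by (subst (1 2) x) (simp add: power2_eq_square)
    moreover have "(\<i> *s x) \<bullet> (G *v x) = (norm x)\<^sup>2 * ((\<i> *s e) \<bullet> (G *v e))"
      unfolding ix by (subst (2) x) (simp add: power2_eq_square)
    ultimately show ?thesis using form[OF e] by simp
  qed simp
  then have "positive_semidefinite G"
    by (simp add: positive_semidefinite_iff self_adjointI)
  then show ?thesis using U G_def by blast
qed

text \<open>The matrices with nonnegative form are a closed convex cone disjoint from
  \<open>K\<close>. A functional separating them is nonnegative on the cone, which contains all
  skew-Hermitian matrices and all \<open>outer x\<close>; this makes \<open>H\<close> Hermitian and
  positive semidefinite.\<close>

lemma accretive_separation:
  fixes K :: "(complex^'n^'n) set"
  assumes "compact K" "convex K" "K \<noteq> {}"
    and none: "\<And>M. M \<in> K \<Longrightarrow> \<exists>x. x \<bullet> (M *v x) < 0"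
  shows "\<exists>H. positive_semidefinite H \<and> (\<forall>M\<in>K. H \<bullet> M < 0)"
proof -
  let ?P = "{M :: complex^'n^'n. \<forall>x. 0 \<le> x \<bullet> (M *v x)}"
  have "closed ?P"
    by (intro closed_Collect_all closed_Collect_le continuous_intros)
  moreover have "convex ?P"
    by (auto simp: convex_def matrix_vector_mult_add_rdistrib inner_add_right)
  moreover have "K \<inter> ?P = {}"
    using none by (auto simp: disjoint_iff not_le)
  ultimately obtain H b where H: "\<And>M. M \<in> K \<Longrightarrow> H \<bullet> M < b" "\<And>M. M \<in> ?P \<Longrightarrow> H \<bullet> M > b"
    using separating_hyperplane_compact_closed[OF assms(2,1,3), of ?P] by blast
  have "b < 0" using H(2)[of 0] by simp
  have nonneg: "0 \<le> H \<bullet> M" if M: "M \<in> ?P" for M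
  proof (rule ccontr)
    assume "\<not> 0 \<le> H \<bullet> M"
    then have neg: "H \<bullet> M < 0" by simp
    \<comment> \<open>Positive multiples stay in the cone, and this one would have inner product
      exactly \<open>b\<close>, against the strict separation.\<close>
    have "(b / (H \<bullet> M)) *\<^sub>R M \<in> ?P"
      using M neg \<open>b < 0\<close> by (auto intro!: mult_nonneg_nonneg mult_nonpos_nonneg divide_nonpos_neg)
    from H(2)[OF this] neg show False by simp
  qed
  have "adj H = H"
  proof -
    \<comment> \<open>\<open>N\<close> is skew-Hermitian, so its form vanishes and both
      \<open>N\<close> and \<open>- N\<close> are in the cone; thus
      \<open>H \<bullet> N = 0\<close>. As \<open>adj\<close> preserves the inner product,
      \<open>N \<bullet> N = 0\<close> follows.\<close>
    define N where "N = H - adj H"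
    have form: "x \<bullet> (N *v x) = 0" for x
    proof -
      have "x \<bullet> (H *v x) = x \<bullet> (adj H *v x)"
        by (metis inner_matrix_vec inner_commute)
      then show ?thesis
        unfolding N_def matrix_vector_mult_diff_rdistrib inner_diff_right by (rule eq_iff_diff_eq_0[THEN iffD1])
    qed
    then have "x \<bullet> (((-1) *\<^sub>R N) *v x) = 0" for x
      unfolding matrix_vector_mult_scaleR_left inner_scaleR_right by (metis mult_zero_right)
    then have "(-1) *\<^sub>R N \<in> ?P" by (intro CollectI allI eq_refl) (rule sym)
    then have "0 \<le> H \<bullet> ((-1) *\<^sub>R N)" by (rule nonneg)
    moreover have "0 \<le> H \<bullet> N" using form by (intro nonneg) simp
    ultimately have HN: "H \<bullet> (H - adj H) = 0"
      unfolding inner_scaleR_right N_def by linarith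
    have "adj H \<bullet> (H - adj H) = - (H \<bullet> (H - adj H))"
    proof -
      have "adj M \<bullet> adj N = M \<bullet> N" for M N :: "complex^'n^'n"
        unfolding inner_vec_def adj_def by (simp add: inner_complex_def, rule sum.swap)
      from this[of H "H - adj H"] show ?thesis by (simp add: adj_diff inner_diff_right)
    qed
    then have "(H - adj H) \<bullet> (H - adj H) = 0"
      unfolding inner_diff_left[of H] by (simp only: HN)
    then show ?thesis by simp
  qed
  moreover have "0 \<le> x \<bullet> (H *v x)" for x
    using nonneg[of "outer x"] inner_outer[of x H] by (simp add: outer_form inner_commute)
  ultimately have "positive_semidefinite H" by (simp add: positive_semidefinite_iff)
  then show ?thesis using H(1) \<open>b < 0\<close> by force
qed

text \<open>This is where the multiplier test turns out to be lossless: a bound that holds vector by vector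
  yields one matrix that works for all vectors.\<close>

lemma uniform_contraction:
  fixes A :: "complex^'n^'n"
  assumes "0 \<le> r" and bound: "\<And>x. (A *v x) \<bullet> (c *s x) \<le> r * norm (A *v x) * norm x"
  shows "\<exists>T. (\<forall>x. norm (T *v x) \<le> r * norm x) \<and> (\<forall>x. 0 \<le> (A *v x) \<bullet> (T *v x - c *s x))"
proof (rule ccontr)
  assume contra: "\<not> ?thesis"
  let ?C = "{T :: complex^'n^'n. \<forall>x. norm (T *v x) \<le> r * norm x}"
  let ?f = "\<lambda>T. adj A ** (T - mat c)"
  have form: "x \<bullet> (?f T *v x) = (A *v x) \<bullet> (T *v x - c *s x)" for x T
    by (simp add: inner_matrix_vec[of x "adj A"] matrix_vector_mult_diff_rdistrib flip: matrix_vector_mul_assoc)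
  have lin: "linear (\<lambda>T. adj A ** T)"
    by (rule linearI) (simp_all add: matrix_add_ldistrib matrix_mult_scaleR_right)
  \<comment> \<open>A linear map followed by a translation: the image of the ball is convex and
    compact.\<close>
  have f: "?f = (\<lambda>M. - (adj A ** mat c) + M) \<circ> (\<lambda>T. adj A ** T)"
    by (simp add: fun_eq_iff matrix_mult_diff_right)
  have "convex ?C"
  proof (rule convexI)
    fix S T :: "complex^'n^'n" and u v :: real
    assume ST: "S \<in> ?C" "T \<in> ?C" and uv: "0 \<le> u" "0 \<le> v" "u + v = 1"
    have "norm ((u *\<^sub>R S + v *\<^sub>R T) *v x) \<le> r * norm x" for x
    proof -
      have "norm ((u *\<^sub>R S + v *\<^sub>R T) *v x) \<le> u * norm (S *v x) + v * norm (T *v x)"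
        using uv norm_triangle_ineq[of "u *\<^sub>R (S *v x)" "v *\<^sub>R (T *v x)"]
        by (simp add: matrix_vector_mult_add_rdistrib)
      also have "\<dots> \<le> u * (r * norm x) + v * (r * norm x)"
        using ST uv by (intro add_mono mult_left_mono) auto
      also have "\<dots> = r * norm x"
        using uv by (simp flip: distrib_right)
      finally show ?thesis .
    qed
    then show "u *\<^sub>R S + v *\<^sub>R T \<in> ?C" by simp
  qed
  then have "convex (?f ` ?C)"
    unfolding f image_comp[symmetric] by (intro convex_translation convex_linear_image lin)
  moreover have "compact (?f ` ?C)"
    unfolding f image_comp[symmetric]
    by (intro compact_translation compact_continuous_image compact_operator_ball
        linear_continuous_on lin[unfolded linear_conv_bounded_linear])
  moreover have "0 \<in> ?C" using \<open>0 \<le> r\<close> by simp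
  then have "?f ` ?C \<noteq> {}" by blast
  moreover have "\<exists>x. x \<bullet> (M *v x) < 0" if "M \<in> ?f ` ?C" for M
    using that contra form by (metis (mono_tags, lifting) imageE mem_Collect_eq not_le)
  ultimately obtain H where psd: "positive_semidefinite H" and neg: "\<And>T. T \<in> ?C \<Longrightarrow> H \<bullet> ?f T < 0"
    using accretive_separation[of "?f ` ?C"] by blast
  obtain U where U: "adj U ** U = mat 1" and psdG: "positive_semidefinite (adj U ** (A ** H))"
    using polar_decomposition[of "A ** H"] by blast
  define B where "B = adj U ** A"
  \<comment> \<open>At \<open>H\<close> this is the negative of the separating functional's value
    for \<open>r *\<^sub>R U\<close>, so \<open>\<phi> H \<le> 0\<close> is the contradiction
    sought.\<close>
  define \<phi> where "\<phi> = (\<lambda>M. (A ** M) \<bullet> mat c - r * ((B ** M) \<bullet> mat 1))"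
  have "linear \<phi>"
    by (rule linearI)
      (simp_all add: \<phi>_def matrix_add_ldistrib matrix_mult_scaleR_right inner_add_left algebra_simps)
  \<comment> \<open>On such an eigenvector Cauchy-Schwarz is an equality: \<open>(B *v v) \<bullet>
    v = k * (norm v)\<^sup>2 = norm (A *v v) * norm v\<close>, and the pointwise bound
    applies.\<close>
  moreover have "\<phi> (outer v) \<le> 0" if k: "0 \<le> k" "B *v v = k *\<^sub>R v" for v k
  proof -
    have "U ** adj U = mat 1" using U matrix_left_right_inverse by blast
    then have "norm (A *v v) = norm (B *v v)"
      using unitary_norm[of "adj U" "A *v v"] by (simp add: B_def matrix_vector_mul_assoc)
    then have nA: "norm (A *v v) = k * norm v" using k by simp
    have "(M ** outer v) \<bullet> N = (M *v v) \<bullet> (N *v v)" for M N :: "complex^'n^'n"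
      using inner_matrix_mult[of N M "outer v"]
      by (simp add: inner_commute[of _ "outer v"] inner_commute[of _ N] inner_outer inner_matrix_vec[of v "adj M"]
          flip: matrix_vector_mul_assoc)
    then have "\<phi> (outer v) = (A *v v) \<bullet> (c *s v) - r * ((B *v v) \<bullet> v)"
      by (simp add: \<phi>_def)
    also have "\<dots> = (A *v v) \<bullet> (c *s v) - r * norm (A *v v) * norm v"
      by (simp add: k nA power2_eq_square flip: power2_norm_eq_inner)
    also have "\<dots> \<le> 0" using bound by simp
    finally show ?thesis .
  qed
  ultimately have "\<phi> H \<le> 0"
    using positive_semidefinite_pair_induct[OF psd, of B \<phi>] psdG
    by (simp add: B_def matrix_mul_assoc)
  moreover have "H \<bullet> ?f (r *\<^sub>R U) < 0"
    using unitary_norm[OF U] \<open>0 \<le> r\<close> by (intro neg) simp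
  moreover have "H \<bullet> ?f (r *\<^sub>R U) = - \<phi> H"
  proof -
    have "(A ** H) \<bullet> U = (B ** H) \<bullet> mat 1"
      using inner_matrix_mult[of "A ** H" U "mat 1"] by (simp add: B_def matrix_mul_assoc)
    moreover have "H \<bullet> ?f (r *\<^sub>R U) = (A ** H) \<bullet> (r *\<^sub>R U - mat c)"
      by (simp add: inner_matrix_mult)
    ultimately show ?thesis by (simp add: \<phi>_def inner_diff_right)
  qed
  ultimately show False by simp
qed

section \<open>The maximum singular value as operator norm\<close>

text \<open>Eigenvectors for distinct real eigenvalues are orthogonal, hence independent, hence
  finitely many. This makes \<open>Max\<close> in \<open>max_singular_value\<close>
  meaningful.\<close>

lemma finite_real_eigenvalues:
  assumes "adj M = M"
  shows "finite {l::real. eigenvalue M (of_real l)}" (is "finite ?S")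
proof -
  have "\<forall>l\<in>?S. \<exists>v. v \<noteq> 0 \<and> M *v v = l *\<^sub>R v"
    by (simp add: eigenvalue_def)
  then obtain f where f: "\<And>l. l \<in> ?S \<Longrightarrow> f l \<noteq> 0 \<and> M *v f l = l *\<^sub>R f l"
    by metis
  have orth: "f l \<bullet> f m = 0" if lm: "l \<in> ?S" "m \<in> ?S" "l \<noteq> m" for l m
  proof -
    have "l * (f l \<bullet> f m) = (adj M *v f l) \<bullet> f m"
      using f[OF lm(1)] by (simp add: assms)
    also have "\<dots> = m * (f l \<bullet> f m)"
      using f[OF lm(2)] by (simp flip: inner_matrix_vec)
    finally show ?thesis using lm(3) by simp
  qed
  have inj: "inj_on f ?S"
  proof (rule inj_onI, rule ccontr)
    fix l m assume lm: "l \<in> ?S" "m \<in> ?S" "f l = f m" "l \<noteq> m"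
    then have "f l = 0" using orth[of l m] by simp
    then show False using f[OF lm(1)] by blast
  qed
  have "pairwise orthogonal (f ` ?S)"
  proof (rule pairwiseI)
    fix x y assume "x \<in> f ` ?S" "y \<in> f ` ?S" "x \<noteq> y"
    then obtain l m where "l \<in> ?S" "m \<in> ?S" "l \<noteq> m" "x = f l" "y = f m" by blast
    then show "orthogonal x y" using orth unfolding orthogonal_def by blast
  qed
  moreover have "0 \<notin> f ` ?S"
  proof
    assume "0 \<in> f ` ?S"
    then obtain l where "l \<in> ?S" "f l = 0" by force
    then show False using f by blast
  qed
  ultimately have "finite (f ` ?S)"
    using pairwise_orthogonal_independent independent_imp_finite by blast
  then show ?thesis using inj finite_imageD by blast
qed

lemma gram_form: "x \<bullet> ((adj M ** M) *v x) = (norm (M *v x))\<^sup>2"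
  by (simp add: power2_norm_eq_inner inner_matrix_vec flip: matrix_vector_mul_assoc)

lemma onorm_attained:
  fixes M :: "complex^'n^'m"
  shows "\<exists>x. norm x = 1 \<and> norm (M *v x) = onorm ((*v) M)"
proof -
  have "axis undefined 1 \<in> sphere (0 :: complex^'n) 1" by simp
  then have "sphere (0 :: complex^'n) 1 \<noteq> {}" by blast
  moreover have "continuous_on (sphere 0 1) (\<lambda>x. norm (M *v x))"
    by (intro continuous_intros)
  ultimately obtain x0 where x0: "x0 \<in> sphere 0 1"
    and max: "\<And>x. x \<in> sphere 0 1 \<Longrightarrow> norm (M *v x) \<le> norm (M *v x0)"
    using continuous_attains_sup[OF compact_sphere] by blast
  have "norm (M *v x) \<le> norm (M *v x0) * norm x" for x
  proof (cases "x = 0")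
    case False
    then show ?thesis using max[of "(1 / norm x) *\<^sub>R x"] by (simp add: field_simps)
  qed simp
  then have "onorm ((*v) M) \<le> norm (M *v x0)" by (rule onorm_le)
  moreover have "norm (M *v x0) \<le> onorm ((*v) M)"
    using onorm[OF bounded_linear_matrix_vec, of M x0] x0 by simp
  ultimately show ?thesis using x0 by force
qed

text \<open>A unit vector maximising \<open>norm (M *v x)\<close> is a zero of the semidefinite form
  of \<open>\<sigma>^2 I - M^H M\<close>, hence in its kernel. So the norm \<sigma> is itself a
  singular value, and it bounds all others.\<close>

lemma max_singular_value_eq_onorm:
  fixes M :: "complex^'n^'m"
  shows "max_singular_value M = onorm ((*v) M)"
proof -
  let ?N = "adj M ** M" and ?\<sigma> = "onorm ((*v) M)"
  have sa: "adj ?N = ?N" by (simp add: adj_mult)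
  have "singular_values M \<subseteq> sqrt ` {l. eigenvalue ?N (of_real l)}"
  proof
    fix s assume "s \<in> singular_values M"
    then have "s = sqrt (s\<^sup>2)" "eigenvalue ?N (of_real (s\<^sup>2))"
      by (simp_all add: singular_values_def)
    then show "s \<in> sqrt ` {l. eigenvalue ?N (of_real l)}" by blast
  qed
  then have fin: "finite (singular_values M)"
    using finite_real_eigenvalues[OF sa] finite_surj by blast
  have le: "s \<le> ?\<sigma>" if s: "s \<in> singular_values M" for s
  proof -
    obtain v where v: "v \<noteq> 0" "?N *v v = s\<^sup>2 *\<^sub>R v" "0 \<le> s"
      using s by (auto simp: singular_values_def eigenvalue_def simp del: of_real_power)
    have "(norm (M *v v))\<^sup>2 = (s * norm v)\<^sup>2"
      using gram_form[of v M] by (simp add: v power_mult_distrib flip: power2_norm_eq_inner)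
    then have "s * norm v = norm (M *v v)"
      using v by (simp add: power2_eq_iff_nonneg)
    then show ?thesis
      using onorm[OF bounded_linear_matrix_vec, of M v] v(1)
      by (metis mult_right_le_imp_le zero_less_norm_iff)
  qed
  obtain x where x: "norm x = 1" "norm (M *v x) = ?\<sigma>" using onorm_attained by blast
  define P where "P = ?\<sigma>\<^sup>2 *\<^sub>R mat 1 - ?N"
  have P: "P *v y = ?\<sigma>\<^sup>2 *\<^sub>R y - ?N *v y" for y
    by (simp add: P_def matrix_vector_mult_diff_rdistrib)
  have form: "y \<bullet> (P *v y) = (?\<sigma> * norm y)\<^sup>2 - (norm (M *v y))\<^sup>2" for y
    by (simp add: P inner_diff_right gram_form power_mult_distrib flip: power2_norm_eq_inner)
  have "positive_semidefinite P"
    unfolding positive_semidefinite_iff form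
    using power_mono[OF onorm[OF bounded_linear_matrix_vec, of M] norm_ge_zero]
    by (simp add: P_def adj_diff adj_scaleR sa)
  then have "P *v x = 0"
    by (rule positive_semidefinite_kernel) (simp add: form x)
  then have "eigenvalue ?N (of_real (?\<sigma>\<^sup>2))"
    using x unfolding eigenvalue_def P of_real_scale by (intro exI[of _ x]) auto
  then have "?\<sigma> \<in> singular_values M"
    by (simp add: singular_values_def onorm_pos_le[OF bounded_linear_matrix_vec])
  then show ?thesis
    unfolding max_singular_value_def using fin le by (intro Max_eqI) auto
qed

section \<open>The inner program\<close>

lemma complex_matrix_diff: "complex_matrix (M - N) = complex_matrix M - complex_matrix N"
  by (simp add: complex_matrix_def vec_eq_iff)

lemma complex_matrix_scaleR: "complex_matrix (a *\<^sub>R M) = a *\<^sub>R complex_matrix M"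
  by (simp add: complex_matrix_def vec_eq_iff) (simp add: scaleR_conv_of_real)

lemma complex_matrix_mat: "complex_matrix (mat a) = mat (of_real a)"
  by (simp add: complex_matrix_def mat_def vec_eq_iff)

text \<open>The matrix inverted in \<open>inner_matrix\<close>, with \<kappa> for
  \<open>(1 - \<delta>) / (1 + \<delta>)\<close>; at \<kappa> = 1 it is the one inverted in
  \<open>transfer_P\<close>.\<close>

definition pencil :: "real^'n^'n \<Rightarrow> real \<Rightarrow> real \<Rightarrow> complex^'n^'n" where
  "pencil A \<omega> \<kappa> = mat (\<i> * of_real \<omega>) - complex_matrix (\<kappa> *\<^sub>R A - mat 1)"

lemma pencil_mult_vec:
  "pencil A \<omega> \<kappa> *v x = (1 + \<i> * of_real \<omega>) *s x - \<kappa> *\<^sub>R (complex_matrix A *v x)"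
  by (simp add: pencil_def complex_matrix_diff complex_matrix_scaleR complex_matrix_mat
      matrix_vector_mult_diff_rdistrib vector_sadd_rdistrib)

lemma stable_matrix_kernel:
  assumes "stable_matrix A" "complex_matrix A *v x = 0"
  shows "x = 0"
proof (rule ccontr)
  assume "x \<noteq> 0"
  then have "eigenvalue (complex_matrix A) 0"
    using assms(2) by (auto simp: eigenvalue_def)
  then show False using assms(1) by (force simp: stable_matrix_def)
qed

text \<open>For \<kappa> > 0 a kernel vector would be an eigenvector of \<open>A\<close> for
  \<open>(1 + j \<omega>) / \<kappa>\<close>, which has positive real part; for \<kappa> = 0 the
  pencil is a nonzero scalar.\<close>

lemma pencil_kernel:
  assumes "stable_matrix A" "0 \<le> \<kappa>" "pencil A \<omega> \<kappa> *v x = 0"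
  shows "x = 0"
proof (rule ccontr)
  assume "x \<noteq> 0"
  have eq: "\<kappa> *\<^sub>R (complex_matrix A *v x) = (1 + \<i> * of_real \<omega>) *s x"
    using assms(3) by (simp add: pencil_mult_vec)
  have "Re (1 + \<i> * of_real \<omega>) = 1" by simp
  then have nz: "1 + \<i> * of_real \<omega> \<noteq> 0" by (metis zero_complex.sel(1) zero_neq_one)
  have "\<kappa> \<noteq> 0"
  proof
    assume "\<kappa> = 0"
    then have "(1 + \<i> * of_real \<omega>) *s x = 0" using eq by (metis scale_zero_left)
    then show False using \<open>x \<noteq> 0\<close> nz by (simp only: vector_mul_eq_0) blast
  qed
  have "complex_matrix A *v x = (1 / \<kappa>) *\<^sub>R (\<kappa> *\<^sub>R (complex_matrix A *v x))"
    using \<open>\<kappa> \<noteq> 0\<close> by simp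
  also have "\<dots> = of_real (1 / \<kappa>) *s ((1 + \<i> * of_real \<omega>) *s x)"
    unfolding eq by (simp only: of_real_scale)
  also have "\<dots> = (of_real (1 / \<kappa>) * (1 + \<i> * of_real \<omega>)) *s x"
    by (simp only: vector_smult_assoc)
  finally have "eigenvalue (complex_matrix A) (of_real (1 / \<kappa>) * (1 + \<i> * of_real \<omega>))"
    using \<open>x \<noteq> 0\<close> unfolding eigenvalue_def by blast
  then have "Re (of_real (1 / \<kappa>) * (1 + \<i> * of_real \<omega>)) < 0"
    using assms(1) unfolding stable_matrix_def by blast
  then show False using \<open>0 \<le> \<kappa>\<close> by simp
qed

lemma invertible_pencil:
  assumes "stable_matrix A" "0 \<le> \<kappa>" shows "invertible (pencil A \<omega> \<kappa>)"
  using pencil_kernel[OF assms] by (metis invertible_left_inverse matrix_left_invertible_ker)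

lemma matrix_inv_mult_vec:
  assumes "invertible (M :: complex^'n^'n)"
  shows "matrix_inv M *v (M *v x) = x" "M *v (matrix_inv M *v x) = x"
proof -
  have "M ** matrix_inv M = mat 1 \<and> matrix_inv M ** M = mat 1"
    using assms unfolding invertible_def matrix_inv_def by (rule someI_ex)
  then show "matrix_inv M *v (M *v x) = x" "M *v (matrix_inv M *v x) = x"
    by (simp_all add: matrix_vector_mul_assoc)
qed

lemma inner_objective_at_minus_one [simp]: "inner_objective A \<omega> (-1) = 0"
proof -
  have zero: "(*v) (0 :: complex^'n^'n) = (\<lambda>x. 0)" by (simp add: fun_eq_iff)
  have "onorm ((*v) (0 :: complex^'n^'n)) = 0" by (subst zero) (rule onorm_zero)
  then show ?thesis
    by (simp add: inner_objective_def inner_matrix_def max_singular_value_eq_onorm)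
qed

text \<open>Substituting \<open>y = pencil x\<close> removes the inverse from the operator norm
  bound.\<close>

lemma inner_objective_le_iff:
  assumes "stable_matrix A" "-1 < \<delta>" "\<delta> \<le> 1"
  shows "inner_objective A \<omega> \<delta> \<le> \<mu>
    \<longleftrightarrow> (\<forall>x. norm x \<le> \<mu> * norm (pencil A \<omega> ((1 - \<delta>) / (1 + \<delta>)) *v x))"
proof -
  let ?R = "pencil A \<omega> ((1 - \<delta>) / (1 + \<delta>))"
  have inv: "invertible ?R" using assms by (intro invertible_pencil) auto
  have obj: "inner_objective A \<omega> \<delta> = onorm ((*v) (matrix_inv ?R))"
    using assms by (simp add: inner_objective_def inner_matrix_def max_singular_value_eq_onorm pencil_def)
  show ?thesis
  proof
    assume le: "inner_objective A \<omega> \<delta> \<le> \<mu>"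
    show "\<forall>x. norm x \<le> \<mu> * norm (?R *v x)"
    proof
      fix x
      have "norm x = norm (matrix_inv ?R *v (?R *v x))"
        by (simp add: matrix_inv_mult_vec inv)
      also have "\<dots> \<le> inner_objective A \<omega> \<delta> * norm (?R *v x)"
        unfolding obj by (rule onorm[OF bounded_linear_matrix_vec])
      also have "\<dots> \<le> \<mu> * norm (?R *v x)"
        using le by (intro mult_right_mono) auto
      finally show "norm x \<le> \<mu> * norm (?R *v x)" .
    qed
  next
    assume "\<forall>x. norm x \<le> \<mu> * norm (?R *v x)"
    then have "norm (matrix_inv ?R *v y) \<le> \<mu> * norm y" for y
      by (metis inv matrix_inv_mult_vec(2))
    then show "inner_objective A \<omega> \<delta> \<le> \<mu>"
      unfolding obj by (rule onorm_le)
  qed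
qed

text \<open>For \<delta> > -1 the objective is the supremum of \<open>h (\<delta>, x)\<close> over
  unit vectors \<open>x\<close>, and \<open>h\<close> is continuous on the whole compact product,
  with value 0 at \<delta> = -1 in agreement with the objective there.\<close>

lemma inner_objective_attains_sup:
  assumes "stable_matrix A"
  shows "\<exists>\<delta>\<^sub>0\<in>{-1..1}. \<forall>\<delta>\<in>{-1..1}. inner_objective A \<omega> \<delta> \<le> inner_objective A \<omega> \<delta>\<^sub>0"
proof -
  \<comment> \<open>The pencil scaled by \<open>1 + \<delta>\<close>, which removes the pole at
    \<delta> = -1: there \<open>- 2 A x\<close> remains, nonzero by stability.\<close>
  define D where "D = (\<lambda>(\<delta>, x). (1 + \<delta>) *\<^sub>R ((1 + \<i> * of_real \<omega>) *s x) - (1 - \<delta>) *\<^sub>R (complex_matrix A *v x))"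
  define h where "h = (\<lambda>p. (1 + fst p) / norm (D p))"
  let ?S = "{-1..1} \<times> sphere 0 1 :: (real \<times> (complex^'n)) set"
  have D: "D (\<delta>, x) = (1 + \<delta>) *\<^sub>R (pencil A \<omega> ((1 - \<delta>) / (1 + \<delta>)) *v x)" if "-1 < \<delta>" for \<delta> x
    using that by (simp add: D_def pencil_mult_vec scaleR_diff_right)
  have Dnz: "D p \<noteq> 0" if "p \<in> ?S" for p
  proof -
    obtain \<delta> x where p: "p = (\<delta>, x)" by (cases p)
    then have \<delta>: "-1 \<le> \<delta>" "\<delta> \<le> 1" and x: "x \<noteq> 0" using that by auto
    show ?thesis
    proof (cases "\<delta> = -1")
      case True
      then show ?thesis using stable_matrix_kernel[OF assms] x by (auto simp: p D_def)
    next
      case False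
      then have "-1 < \<delta>" using \<delta> by simp
      moreover have "pencil A \<omega> ((1 - \<delta>) / (1 + \<delta>)) *v x \<noteq> 0"
        using pencil_kernel[OF assms, of "(1 - \<delta>) / (1 + \<delta>)"] x \<delta> by force
      ultimately show ?thesis by (simp add: p D)
    qed
  qed
  have "axis undefined 1 \<in> sphere (0 :: complex^'n) 1" by simp
  then have "?S \<noteq> {}" by force
  moreover have "compact ?S" by (intro compact_Times compact_Icc compact_sphere)
  moreover have "continuous_on ?S h"
  proof -
    have "D = (\<lambda>p. (1 + fst p) *\<^sub>R (mat (1 + \<i> * of_real \<omega>) *v snd p)
        - (1 - fst p) *\<^sub>R (complex_matrix A *v snd p))"
      by (simp add: D_def fun_eq_iff)
    then have "continuous_on ?S D"
      by (simp only:) (intro continuous_intros)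
    then show ?thesis
      unfolding h_def using Dnz by (intro continuous_intros) auto
  qed
  ultimately obtain p where p: "p \<in> ?S" and max: "\<And>q. q \<in> ?S \<Longrightarrow> h q \<le> h p"
    using continuous_attains_sup[of ?S h] by blast
  obtain \<delta>\<^sub>0 x\<^sub>0 where p_eq: "p = (\<delta>\<^sub>0, x\<^sub>0)" by (cases p)
  then have \<delta>\<^sub>0: "-1 \<le> \<delta>\<^sub>0" "\<delta>\<^sub>0 \<le> 1" and x\<^sub>0: "norm x\<^sub>0 = 1" using p by auto
  have "0 \<le> h p" using \<delta>\<^sub>0 by (simp add: h_def p_eq)
  have upper: "inner_objective A \<omega> \<delta> \<le> h p" if \<delta>: "\<delta> \<in> {-1..1}" for \<delta>
  proof (cases "\<delta> = -1")
    case True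
    then show ?thesis using \<open>0 \<le> h p\<close> by simp
  next
    case False
    then have \<delta>': "-1 < \<delta>" "\<delta> \<le> 1" using \<delta> by auto
    let ?R = "pencil A \<omega> ((1 - \<delta>) / (1 + \<delta>))"
    have "norm x \<le> h p * norm (?R *v x)" for x
    proof (cases "x = 0")
      case False
      define e where "e = (1 / norm x) *\<^sub>R x"
      have e: "(\<delta>, e) \<in> ?S" using False \<delta> by (simp add: e_def)
      have "norm (?R *v e) \<noteq> 0"
        using Dnz[OF e] by (simp add: D[OF \<delta>'(1)])
      moreover have "h (\<delta>, e) = 1 / norm (?R *v e)"
        using \<delta>' by (simp add: h_def D)
      ultimately have "1 \<le> h p * norm (?R *v e)"
        using mult_right_mono[OF max[OF e], of "norm (?R *v e)"] by simp
      then show ?thesis using False by (simp add: e_def field_simps)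
    qed simp
    then show ?thesis using inner_objective_le_iff[OF assms \<delta>'] by blast
  qed
  have "h p \<le> inner_objective A \<omega> \<delta>\<^sub>0"
  proof (cases "\<delta>\<^sub>0 = -1")
    case True
    then show ?thesis by (simp add: h_def p_eq)
  next
    case False
    then have gt: "-1 < \<delta>\<^sub>0" using \<delta>\<^sub>0 by simp
    let ?R = "pencil A \<omega> ((1 - \<delta>\<^sub>0) / (1 + \<delta>\<^sub>0))"
    have "1 \<le> inner_objective A \<omega> \<delta>\<^sub>0 * norm (?R *v x\<^sub>0)"
      using inner_objective_le_iff[OF assms gt \<delta>\<^sub>0(2), of \<omega> "inner_objective A \<omega> \<delta>\<^sub>0"] x\<^sub>0
      by (metis order_refl)
    moreover have "norm (?R *v x\<^sub>0) > 0"
      using Dnz[OF p] by (simp add: p_eq D[OF gt])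
    moreover have "h p = 1 / norm (?R *v x\<^sub>0)"
      using gt by (simp add: h_def p_eq D)
    ultimately show ?thesis by (simp only: pos_divide_le_eq)
  qed
  moreover have "\<delta>\<^sub>0 \<in> {-1..1}" using \<delta>\<^sub>0 by simp
  ultimately show ?thesis using upper by (meson order_trans)
qed

section \<open>The constraint as a quadratic form\<close>

definition upper :: "'a^('p::finite + 'q::finite) \<Rightarrow> 'a^'p" where
  "upper v = (\<chi> i. v $ Inl i)"

definition lower :: "'a^('p::finite + 'q::finite) \<Rightarrow> 'a^'q" where
  "lower v = (\<chi> i. v $ Inr i)"

definition join :: "'a^'p \<Rightarrow> 'a^'q \<Rightarrow> 'a^('p::finite + 'q::finite)" where
  "join x y = (\<chi> i. case i of Inl k \<Rightarrow> x $ k | Inr k \<Rightarrow> y $ k)"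

lemma upper_join [simp]: "upper (join x y) = x"
  and lower_join [simp]: "lower (join x y) = y"
  by (simp_all add: upper_def lower_def join_def vec_eq_iff)

lemma upper_zero [simp]: "upper 0 = 0" and lower_zero [simp]: "lower 0 = 0"
  by (simp_all add: upper_def lower_def vec_eq_iff)

lemma upper_lower_eqI:
  assumes "upper v = upper w" "lower v = lower w" shows "v = w"
proof -
  have "v $ i = w $ i" for i
    using assms by (cases i) (simp_all add: upper_def lower_def vec_eq_iff)
  then show ?thesis by (simp add: vec_eq_iff)
qed

lemma upper_add: "upper (v + w) = upper v + upper w"
  and lower_add: "lower (v + w) = lower v + lower w"
  by (simp_all add: upper_def lower_def vec_eq_iff)

lemma sum_UNIV_Plus:
  "(\<Sum>i\<in>(UNIV :: ('p::finite + 'q::finite) set). f i)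
    = (\<Sum>i\<in>UNIV. f (Inl i)) + (\<Sum>i\<in>UNIV. f (Inr i))"
  using sum.Plus[of "UNIV :: 'p set" "UNIV :: 'q set" f] by (simp add: comp_def)

lemma inner_upper_lower: "x \<bullet> y = upper x \<bullet> upper y + lower x \<bullet> lower y"
  for x y :: "complex^('p::finite + 'q::finite)"
  by (simp add: inner_vec_def sum_UNIV_Plus upper_def lower_def)

lemma upper_vstack [simp]: "upper (vstack M N *v x) = M *v x"
  and lower_vstack [simp]: "lower (vstack M N *v x) = N *v x"
  by (simp_all add: vstack_def upper_def lower_def matrix_vector_mult_def vec_eq_iff)

lemma hstack_mult_vec: "hstack M N *v x = M *v upper x + N *v (lower x :: complex^'q::finite)"
  by (simp add: hstack_def upper_def lower_def matrix_vector_mult_def vec_eq_iff sum_UNIV_Plus)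

lemma upper_block [simp]:
    "upper (block M11 M12 M21 M22 *v x) = M11 *v upper x + M12 *v (lower x :: complex^'q::finite)"
  and lower_block [simp]:
    "lower (block M11 M12 M21 M22 *v x) = M21 *v upper x + M22 *v (lower x :: complex^'q::finite)"
  by (simp_all add: block_def hstack_mult_vec)

lemma adj_block: "adj (block M11 M12 M21 M22) = block (adj M11) (adj M21) (adj M12) (adj M22)"
  by (simp add: adj_def block_def vstack_def hstack_def vec_eq_iff split: sum.split)

text \<open>With \<open>upper v\<close> as \<open>w_\<delta>\<close> and \<open>lower v\<close> as
  \<open>w\<close>, this is the state \<open>x\<close> of the system at frequency \<omega>.\<close>

definition state :: "real^'n^'n \<Rightarrow> real \<Rightarrow> complex^('n + 'n) \<Rightarrow> complex^'n" where
  "state A \<omega> v = matrix_inv (pencil A \<omega> 1) *v (sqrt 2 *\<^sub>R upper v + lower v)"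

text \<open>The output \<open>z_\<delta>\<close> for the same input.\<close>

definition channel :: "real^'n^'n \<Rightarrow> real \<Rightarrow> complex^('n + 'n) \<Rightarrow> complex^'n" where
  "channel A \<omega> v = - upper v - sqrt 2 *\<^sub>R (complex_matrix A *v state A \<omega> v)"

lemma transfer_P_mult_vec:
  "upper (transfer_P A (\<i> * of_real \<omega>) *v v) = channel A \<omega> v"
  "lower (transfer_P A (\<i> * of_real \<omega>) *v v) = state A \<omega> v"
proof -
  have R: "pencil A \<omega> 1 = mat (\<i> * of_real \<omega>) - complex_matrix (A - mat 1)"
    by (simp add: pencil_def)
  show "upper (transfer_P A (\<i> * of_real \<omega>) *v v) = channel A \<omega> v"
    "lower (transfer_P A (\<i> * of_real \<omega>) *v v) = state A \<omega> v"
    by (simp_all add: transfer_P_def channel_def state_def R matrix_vector_mult_add_rdistrib upper_add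
        lower_add minus_matrix_vec complex_matrix_scaleR hstack_mult_vec flip: matrix_vector_mul_assoc)
qed

text \<open>The argument \<open>g\<close> stands for \<open>\<gamma>\<^sup>2\<close>, so that the
  form is affine in \<open>(X, Y, g)\<close>.\<close>

definition sdp_form ::
  "real^'n^'n \<Rightarrow> real \<Rightarrow> complex^'n^'n \<Rightarrow> complex^'n^'n \<Rightarrow> real \<Rightarrow> complex^('n + 'n) \<Rightarrow> real" where
  "sdp_form A \<omega> X Y g v =
     channel A \<omega> v \<bullet> (X *v channel A \<omega> v) + 2 * (channel A \<omega> v \<bullet> (Y *v upper v))
     + (norm (state A \<omega> v))\<^sup>2 - upper v \<bullet> (X *v upper v) - g * (norm (lower v))\<^sup>2"

lemma sdp_lhs_form:
  fixes A :: "real^'n^'n"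
  shows "v \<bullet> (sdp_lhs A \<omega> X Y \<gamma> *v v) = sdp_form A \<omega> X Y (\<gamma>\<^sup>2) v"
proof -
  define PI where "PI = vstack (transfer_P A (\<i> * complex_of_real \<omega>)) (mat 1 :: complex^('n+'n)^('n+'n))"
  have PI: "upper (upper (PI *v v)) = channel A \<omega> v" "lower (upper (PI *v v)) = state A \<omega> v"
    "upper (lower (PI *v v)) = upper v" "lower (lower (PI *v v)) = lower v"
    by (simp_all add: PI_def transfer_P_mult_vec)
  have "v \<bullet> (sdp_lhs A \<omega> X Y \<gamma> *v v) = (PI *v v) \<bullet> (multiplier X Y \<gamma> *v (PI *v v))"
    by (simp add: sdp_lhs_def Let_def inner_matrix_vec[of v "adj PI"] flip: PI_def matrix_vector_mul_assoc)
  also have "\<dots> = sdp_form A \<omega> X Y (\<gamma>\<^sup>2) v"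
  proof -
    \<comment> \<open>The blocks \<open>Y\<close> and \<open>adj Y\<close> contribute equally,
      whence the factor 2.\<close>
    have "upper v \<bullet> (adj Y *v channel A \<omega> v) = channel A \<omega> v \<bullet> (Y *v upper v)"
      by (simp add: inner_matrix_vec[of "upper v"] inner_commute)
    moreover have "mat (- (complex_of_real \<gamma>)\<^sup>2) *v w = - (\<gamma>\<^sup>2 *\<^sub>R w)" for w :: "complex^'n"
      using of_real_scale[of "- (\<gamma>\<^sup>2)" w] by simp
    ultimately show ?thesis
      by (simp add: multiplier_def inner_upper_lower[of "PI *v v"] inner_upper_lower[of "upper (PI *v v)"]
          inner_upper_lower[of "lower (PI *v v)"] upper_add lower_add PI sdp_form_def
          inner_add_right minus_matrix_vec power2_norm_eq_inner del: mat_mult_vec)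
  qed
  finally show ?thesis .
qed

lemma adj_sdp_lhs:
  assumes "adj X = X" shows "adj (sdp_lhs A \<omega> X Y \<gamma>) = sdp_lhs A \<omega> X Y \<gamma>"
  by (simp add: sdp_lhs_def Let_def adj_mult multiplier_def adj_block adj_uminus assms matrix_mul_assoc)

text \<open>\<open>adj_sdp_lhs\<close> supplies the Hermitian part of the order, which reduces the
  matrix inequality to one between quadratic forms.\<close>

lemma sdp_feasible_iff:
  fixes A :: "real^'n^'n"
  shows "(X, Y, \<gamma>) \<in> sdp_feasible A \<omega> \<epsilon> \<longleftrightarrow>
    adj Y = - Y \<and> positive_semidefinite X \<and> 0 \<le> \<gamma> \<and>
    (\<forall>v. sdp_form A \<omega> X Y (\<gamma>\<^sup>2) v \<le> - \<epsilon> * (norm v)\<^sup>2)"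
proof -
  have scale: "mat (complex_of_real (- \<epsilon>)) *v v = - (\<epsilon> *\<^sub>R v)" for v :: "complex^('n + 'n)"
    using of_real_scale[of "- \<epsilon>" v] by simp
  have "v \<bullet> ((mat (complex_of_real (- \<epsilon>)) - sdp_lhs A \<omega> X Y \<gamma>) *v v)
      = - \<epsilon> * (norm v)\<^sup>2 - sdp_form A \<omega> X Y (\<gamma>\<^sup>2) v" for v
    unfolding matrix_vector_mult_diff_rdistrib scale inner_diff_right sdp_lhs_form
    by (simp add: power2_norm_eq_inner)
  then have "sdp_lhs A \<omega> X Y \<gamma> \<preceq> mat (complex_of_real (- \<epsilon>)) \<longleftrightarrow>
      (\<forall>v. sdp_form A \<omega> X Y (\<gamma>\<^sup>2) v \<le> - \<epsilon> * (norm v)\<^sup>2)" if "adj X = X"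
    using that by (simp add: loewner_le_def positive_semidefinite_iff adj_diff adj_sdp_lhs)
  then show ?thesis
    by (auto simp: sdp_feasible_def loewner_le_def positive_semidefinite_iff)
qed

lemma sdp_form_affine:
  assumes "s + t = 1"
  shows "sdp_form A \<omega> (s *\<^sub>R X + t *\<^sub>R X') (s *\<^sub>R Y + t *\<^sub>R Y') (s * g + t * g') v
    = s * sdp_form A \<omega> X Y g v + t * sdp_form A \<omega> X' Y' g' v"
proof -
  have "(norm (state A \<omega> v))\<^sup>2 = s * (norm (state A \<omega> v))\<^sup>2 + t * (norm (state A \<omega> v))\<^sup>2"
    using assms by (simp flip: distrib_right)
  then show ?thesis
    unfolding sdp_form_def matrix_vector_mult_add_rdistrib matrix_vector_mult_scaleR_left
      inner_add_right inner_scaleR_right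
    by (simp add: algebra_simps)
qed

lemma convex_sdp_feasible_squared: "convex (sdp_feasible_squared A \<omega> \<epsilon>)"
proof (rule convexI)
  fix p q and s t :: real
  assume p: "p \<in> sdp_feasible_squared A \<omega> \<epsilon>" and q: "q \<in> sdp_feasible_squared A \<omega> \<epsilon>"
    and st: "0 \<le> s" "0 \<le> t" "s + t = 1"
  obtain X Y \<gamma> where p_eq: "p = (X, Y, \<gamma>\<^sup>2)" and feas: "(X, Y, \<gamma>) \<in> sdp_feasible A \<omega> \<epsilon>"
    using p by (auto simp: sdp_feasible_squared_def)
  obtain X' Y' \<gamma>' where q_eq: "q = (X', Y', \<gamma>'\<^sup>2)" and feas': "(X', Y', \<gamma>') \<in> sdp_feasible A \<omega> \<epsilon>"
    using q by (auto simp: sdp_feasible_squared_def)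
  \<comment> \<open>Convex combinations are taken of the squares, while feasibility speaks of the
    nonnegative root.\<close>
  define \<eta> where "\<eta> = sqrt (s * \<gamma>\<^sup>2 + t * \<gamma>'\<^sup>2)"
  have \<eta>: "0 \<le> \<eta>" "\<eta>\<^sup>2 = s * \<gamma>\<^sup>2 + t * \<gamma>'\<^sup>2"
    using st by (simp_all add: \<eta>_def)
  have "(s *\<^sub>R X + t *\<^sub>R X', s *\<^sub>R Y + t *\<^sub>R Y', \<eta>) \<in> sdp_feasible A \<omega> \<epsilon>"
    unfolding sdp_feasible_iff
  proof (intro conjI allI)
    show "adj (s *\<^sub>R Y + t *\<^sub>R Y') = - (s *\<^sub>R Y + t *\<^sub>R Y')"
      using feas feas' by (simp add: sdp_feasible_iff adj_add adj_scaleR)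
    show "positive_semidefinite (s *\<^sub>R X + t *\<^sub>R X')"
      using feas feas' st
      by (simp add: sdp_feasible_iff positive_semidefinite_iff adj_add adj_scaleR
          matrix_vector_mult_add_rdistrib inner_add_right)
    show "0 \<le> \<eta>" by (rule \<eta>)
    fix v
    have "s * sdp_form A \<omega> X Y (\<gamma>\<^sup>2) v + t * sdp_form A \<omega> X' Y' (\<gamma>'\<^sup>2) v
        \<le> s * (- \<epsilon> * (norm v)\<^sup>2) + t * (- \<epsilon> * (norm v)\<^sup>2)"
      using feas feas' st by (intro add_mono mult_left_mono) (simp_all add: sdp_feasible_iff)
    also have "\<dots> = - \<epsilon> * (norm v)\<^sup>2"
      by (simp only: st(3) mult_1 flip: distrib_right)
    finally show "sdp_form A \<omega> (s *\<^sub>R X + t *\<^sub>R X') (s *\<^sub>R Y + t *\<^sub>R Y') (\<eta>\<^sup>2) v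
        \<le> - \<epsilon> * (norm v)\<^sup>2"
      unfolding \<eta>(2) sdp_form_affine[OF st(3)] .
  qed
  then have "(s *\<^sub>R X + t *\<^sub>R X', s *\<^sub>R Y + t *\<^sub>R Y', \<eta>\<^sup>2) \<in> sdp_feasible_squared A \<omega> \<epsilon>"
    unfolding sdp_feasible_squared_def by (rule rev_image_eqI) simp
  then show "s *\<^sub>R p + t *\<^sub>R q \<in> sdp_feasible_squared A \<omega> \<epsilon>"
    by (simp add: p_eq q_eq \<eta>(2))
qed

text \<open>With \<open>a = A x\<close>, the channel input is \<open>(u - a) / sqrt 2\<close> and
  its output \<open>- (a + u) / sqrt 2\<close>. In the coordinates \<open>x\<close> and
  \<open>u\<close> the multiplier enters only through the single matrix
  \<open>X - Y\<close>.\<close>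

lemma sdp_form_state:
  fixes A :: "real^'n^'n" and \<omega> :: real and v :: "complex^('n + 'n)"
  assumes "stable_matrix A" "adj X = X" "adj Y = - Y"
  defines "c \<equiv> 1 + \<i> * of_real \<omega>"
  defines "x \<equiv> state A \<omega> v"
  defines "u \<equiv> complex_matrix A *v x + sqrt 2 *\<^sub>R upper v"
  shows "lower v = c *s x - u"
    and "sdp_form A \<omega> X Y g v
      = 2 * ((complex_matrix A *v x) \<bullet> ((X - Y) *v u)) + (norm x)\<^sup>2 - g * (norm (c *s x - u))\<^sup>2"
proof -
  have "pencil A \<omega> 1 *v x = sqrt 2 *\<^sub>R upper v + lower v"
    unfolding x_def state_def
    by (rule matrix_inv_mult_vec) (intro invertible_pencil assms(1), simp)
  then show low: "lower v = c *s x - u"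
    by (simp add: pencil_mult_vec c_def u_def algebra_simps)
  define a where "a = complex_matrix A *v x"
  have uv: "upper v = (1 / sqrt 2) *\<^sub>R (u - a)"
    by (simp add: u_def a_def)
  have "sqrt 2 = (1 / sqrt 2) * 2"
    by (simp add: real_div_sqrt)
  then have "sqrt 2 *\<^sub>R a = (1 / sqrt 2) *\<^sub>R (2 *\<^sub>R a)"
    by (metis scaleR_scaleR)
  then have ch: "channel A \<omega> v = (1 / sqrt 2) *\<^sub>R (- (a + u))"
    unfolding channel_def uv x_def[symmetric] a_def[symmetric]
    by (simp add: algebra_simps scaleR_2)
  have scal: "((1 / sqrt 2) *\<^sub>R p) \<bullet> (M *v ((1 / sqrt 2) *\<^sub>R q)) = (p \<bullet> (M *v q)) / 2" for p q :: "complex^'n" and M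
    by simp
  have X: "p \<bullet> (X *v q) = q \<bullet> (X *v p)" for p q
    using inner_matrix_vec[of p X q] assms(2) by (simp add: inner_commute)
  have Y: "p \<bullet> (Y *v q) = - (q \<bullet> (Y *v p))" for p q
    using inner_matrix_vec[of p Y q] assms(3) by (simp add: inner_commute minus_matrix_vec)
  have neg: "M *v (- p) = - (M *v p)" for p :: "complex^'n" and M :: "complex^'n^'n"
    using matrix_vector_mult_scaleR_right[of M "-1" p] by simp
  \<comment> \<open>The pure squares cancel here for Hermitian \<open>X\<close>, and in the next
    identity they vanish for skew-Hermitian \<open>Y\<close>; only the cross terms stay.\<close>
  have "(- (a + u)) \<bullet> (X *v (- (a + u))) - (u - a) \<bullet> (X *v (u - a)) = 4 * (a \<bullet> (X *v u))"
    using X[of u a]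
    by (simp add: neg matrix_vector_right_distrib matrix_vector_mult_diff_distrib inner_add_left inner_add_right
        inner_diff_left inner_diff_right)
  moreover have "(- (a + u)) \<bullet> (Y *v (u - a)) = - 2 * (a \<bullet> (Y *v u))"
    using Y[of u a] Y[of u u] Y[of a a]
    by (simp add: matrix_vector_mult_diff_distrib inner_add_left inner_diff_right inner_diff_left)
  ultimately show "sdp_form A \<omega> X Y g v
      = 2 * ((complex_matrix A *v x) \<bullet> ((X - Y) *v u)) + (norm x)\<^sup>2 - g * (norm (c *s x - u))\<^sup>2"
    unfolding sdp_form_def ch uv scal low x_def[symmetric] a_def[symmetric]
    by (simp add: matrix_vector_mult_diff_rdistrib inner_diff_right)
qed

text \<open>Closing the loop \<open>w_\<delta> = \<delta> z_\<delta>\<close> makes the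
  \<open>X\<close> term nonnegative and the \<open>Y\<close> term zero, so the constraint leaves the
  gain bound.\<close>

lemma inner_objective_le_feasible:
  assumes "stable_matrix A" "0 < \<epsilon>" "(X, Y, \<gamma>) \<in> sdp_feasible A \<omega> \<epsilon>" "\<delta> \<in> {-1..1}"
  shows "inner_objective A \<omega> \<delta> \<le> \<gamma>"
proof (cases "\<delta> = -1")
  case True
  then show ?thesis using assms(3) by (simp add: sdp_feasible_iff)
next
  case False
  then have \<delta>: "-1 < \<delta>" "\<delta> \<le> 1" using assms(4) by auto
  define \<kappa> where "\<kappa> = (1 - \<delta>) / (1 + \<delta>)"
  have "0 \<le> \<kappa>" using \<delta> by (simp add: \<kappa>_def)
  have Y: "adj Y = - Y" and X: "adj X = X" "\<And>y. 0 \<le> y \<bullet> (X *v y)" and \<gamma>: "0 \<le> \<gamma>"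
    and form: "\<And>v. sdp_form A \<omega> X Y (\<gamma>\<^sup>2) v \<le> - \<epsilon> * (norm v)\<^sup>2"
    using assms(3) by (auto simp: sdp_feasible_iff positive_semidefinite_iff)
  have "norm x \<le> \<gamma> * norm (pencil A \<omega> \<kappa> *v x)" for x
  proof -
    define a where "a = complex_matrix A *v x"
    \<comment> \<open>The closed-loop input with state \<open>x\<close>: its upper part is chosen to
      give \<open>u = \<kappa> A x\<close>.\<close>
    define v where "v = join ((1 / sqrt 2) *\<^sub>R (\<kappa> *\<^sub>R a - a)) (pencil A \<omega> \<kappa> *v x)"
    have "sqrt 2 *\<^sub>R upper v + lower v = pencil A \<omega> 1 *v x"
      by (simp add: v_def a_def pencil_mult_vec)
    then have st: "state A \<omega> v = x"
      by (simp add: state_def matrix_inv_mult_vec invertible_pencil assms(1))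
    have u: "complex_matrix A *v x + sqrt 2 *\<^sub>R upper v = \<kappa> *\<^sub>R a"
      by (simp add: v_def a_def)
    have Ya: "a \<bullet> (Y *v a) = 0"
      using inner_matrix_vec[of a Y a] Y by (simp add: inner_commute minus_matrix_vec)
    have "sdp_form A \<omega> X Y (\<gamma>\<^sup>2) v =
        2 * (a \<bullet> ((X - Y) *v (\<kappa> *\<^sub>R a))) + (norm x)\<^sup>2 - \<gamma>\<^sup>2 * (norm (pencil A \<omega> \<kappa> *v x))\<^sup>2"
      using sdp_form_state(2)[OF assms(1) X(1) Y, of \<omega> "\<gamma>\<^sup>2" v]
      unfolding st u by (simp add: pencil_mult_vec a_def)
    also have "a \<bullet> ((X - Y) *v (\<kappa> *\<^sub>R a)) = \<kappa> * (a \<bullet> (X *v a))"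
      by (simp add: matrix_vector_mult_diff_rdistrib inner_diff_right Ya)
    finally have "2 * (\<kappa> * (a \<bullet> (X *v a))) + (norm x)\<^sup>2 - \<gamma>\<^sup>2 * (norm (pencil A \<omega> \<kappa> *v x))\<^sup>2 \<le> - \<epsilon> * (norm v)\<^sup>2"
      using form[of v] by simp
    moreover have "0 \<le> \<kappa> * (a \<bullet> (X *v a))" using \<open>0 \<le> \<kappa>\<close> X(2) by simp
    moreover have "0 \<le> \<epsilon> * (norm v)\<^sup>2" using assms(2) by simp
    ultimately have "(norm x)\<^sup>2 \<le> (\<gamma> * norm (pencil A \<omega> \<kappa> *v x))\<^sup>2"
      by (simp add: power_mult_distrib)
    then show ?thesis by (rule power2_le_imp_le) (simp add: \<gamma>)
  qed
  then show ?thesis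
    using inner_objective_le_iff[OF assms(1) \<delta>] by (simp add: \<kappa>_def)
qed

section \<open>Strict feasibility\<close>

text \<open>The form attains a negative maximum on the compact unit sphere; homogeneity does the
  rest.\<close>

lemma negative_definite_gap:
  fixes L :: "complex^'n^'n"
  assumes "\<And>v. v \<noteq> 0 \<Longrightarrow> v \<bullet> (L *v v) < 0"
  shows "\<exists>\<epsilon>>0. \<forall>v. v \<bullet> (L *v v) \<le> - \<epsilon> * (norm v)\<^sup>2"
proof -
  have "axis undefined 1 \<in> sphere (0 :: complex^'n) 1" by simp
  then have "sphere (0 :: complex^'n) 1 \<noteq> {}" by blast
  moreover have "continuous_on (sphere 0 1) (\<lambda>v. v \<bullet> (L *v v))"
    by (intro continuous_intros)
  ultimately obtain v0 where v0: "v0 \<in> sphere 0 1"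
    and max: "\<And>v. v \<in> sphere 0 1 \<Longrightarrow> v \<bullet> (L *v v) \<le> v0 \<bullet> (L *v v0)"
    using continuous_attains_sup[OF compact_sphere] by blast
  have "v \<bullet> (L *v v) \<le> (v0 \<bullet> (L *v v0)) * (norm v)\<^sup>2" for v
  proof (cases "v = 0")
    case False
    then show ?thesis
      using max[of "(1 / norm v) *\<^sub>R v"] by (simp add: field_simps power2_eq_square)
  qed simp
  moreover have "v0 \<bullet> (L *v v0) < 0" using v0 by (intro assms) auto
  ultimately show ?thesis by (intro exI[of _ "- (v0 \<bullet> (L *v v0))"]) simp
qed

lemma norm_diff_square: "(norm (p - q))\<^sup>2 = (norm p)\<^sup>2 - 2 * (p \<bullet> q) + (norm q)\<^sup>2"
  for p q :: "'a::real_inner"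
  by (simp add: power2_norm_eq_inner inner_diff_left inner_diff_right inner_commute)

text \<open>The bounds for all \<delta> keep \<open>c x\<close> at distance at least
  \<open>norm x / \<gamma>\<close> from the ray of nonnegative multiples of \<open>A x\<close>.
  Taking the nearest point of the ray turns this into an angle condition.\<close>

lemma pointwise_bound:
  fixes A :: "real^'n^'n" and \<omega> \<gamma> :: real
  assumes "stable_matrix A" and obj: "\<And>\<delta>. \<delta> \<in> {-1..1} \<Longrightarrow> inner_objective A \<omega> \<delta> \<le> \<gamma>"
  defines "c \<equiv> 1 + \<i> * of_real \<omega>"
  defines "r \<equiv> sqrt ((norm c)\<^sup>2 - 1 / \<gamma>\<^sup>2)"
  shows "0 < \<gamma>" "1 / \<gamma>\<^sup>2 \<le> (norm c)\<^sup>2"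
    and "(complex_matrix A *v x) \<bullet> (c *s x) \<le> r * norm (complex_matrix A *v x) * norm x"
proof -
  have dist: "norm x \<le> \<gamma> * norm (c *s x - \<kappa> *\<^sub>R (complex_matrix A *v x))" if "0 \<le> \<kappa>" for \<kappa> x
  proof -
    \<comment> \<open>The map \<open>\<kappa> = (1 - \<delta>) / (1 + \<delta>)\<close> is its own
      inverse and takes \<delta> in (-1, 1] onto the nonnegative half-line.\<close>
    define \<delta> where "\<delta> = (1 - \<kappa>) / (1 + \<kappa>)"
    have \<delta>: "-1 < \<delta>" "\<delta> \<le> 1" "(1 - \<delta>) / (1 + \<delta>) = \<kappa>"
      using that by (simp_all add: \<delta>_def field_simps)
    then show ?thesis
      using obj[of \<delta>] inner_objective_le_iff[OF assms(1) \<delta>(1,2), of \<omega> \<gamma>]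
      by (simp add: pencil_mult_vec c_def)
  qed
  \<comment> \<open>The choice \<kappa> = 0 is \<delta> = 1, where the objective equals
    \<open>1 / norm c\<close>.\<close>
  have one: "1 \<le> \<gamma> * norm c"
    using dist[of 0 "axis undefined 1"] by simp
  then show "0 < \<gamma>"
    by (smt (verit) mult_nonpos_nonneg norm_ge_zero)
  have "1\<^sup>2 \<le> (\<gamma> * norm c)\<^sup>2" using one by (intro power_mono) simp_all
  then show le: "1 / \<gamma>\<^sup>2 \<le> (norm c)\<^sup>2"
    using \<open>0 < \<gamma>\<close> by (simp add: field_simps)
  have r: "0 \<le> r" "r\<^sup>2 = (norm c)\<^sup>2 - 1 / \<gamma>\<^sup>2" using le by (simp_all add: r_def)
  define a where "a = complex_matrix A *v x"
  define q where "q = a \<bullet> (c *s x)"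
  have "q \<le> r * norm a * norm x"
  proof (cases "q \<le> 0")
    case True
    then show ?thesis using r by (meson mult_nonneg_nonneg norm_ge_zero order_trans)
  next
    case False
    then have "norm a > 0" by (auto simp: q_def)
    \<comment> \<open>\<open>\<kappa> a\<close> is the point of the ray through \<open>a\<close> nearest to \<open>c x\<close>.\<close>
    define \<kappa> where "\<kappa> = q / (norm a)\<^sup>2"
    have "(norm x)\<^sup>2 \<le> (\<gamma> * norm (c *s x - \<kappa> *\<^sub>R a))\<^sup>2"
      using dist[of \<kappa> x] False by (intro power_mono) (simp_all add: a_def \<kappa>_def)
    also have "\<dots> = \<gamma>\<^sup>2 * ((norm (c *s x))\<^sup>2 - 2 * \<kappa> * q + \<kappa>\<^sup>2 * (norm a)\<^sup>2)"
      by (simp add: q_def power_mult_distrib norm_diff_square inner_commute)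
    also have "\<dots> = \<gamma>\<^sup>2 * ((norm c)\<^sup>2 * (norm x)\<^sup>2 - q\<^sup>2 / (norm a)\<^sup>2)"
      using \<open>norm a > 0\<close> by (simp add: \<kappa>_def power_mult_distrib field_simps power2_eq_square)
    finally have "q\<^sup>2 / (norm a)\<^sup>2 \<le> r\<^sup>2 * (norm x)\<^sup>2"
      using \<open>0 < \<gamma>\<close> by (simp add: r(2) field_simps)
    then have "q\<^sup>2 \<le> (r * norm a * norm x)\<^sup>2"
      using \<open>norm a > 0\<close> by (simp add: power_mult_distrib field_simps)
    then show ?thesis by (rule power2_le_imp_le) (simp add: r)
  qed
  then show "(complex_matrix A *v x) \<bullet> (c *s x) \<le> r * norm (complex_matrix A *v x) * norm x"
    by (simp add: q_def a_def)
qed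

text \<open>A common contraction \<open>T\<close> for the bound \<mu> yields the multiplier for
  \<gamma>; the slack between \<mu> and \<gamma> makes the constraint strict, which leaves room for
  some positive \<epsilon>.\<close>

lemma sdp_strictly_feasible:
  fixes A :: "real^'n^'n"
  assumes "stable_matrix A" and obj: "\<And>\<delta>. \<delta> \<in> {-1..1} \<Longrightarrow> inner_objective A \<omega> \<delta> \<le> \<mu>" and "\<mu> < \<gamma>"
  shows "\<exists>X Y. \<exists>\<epsilon>\<^sub>0>0. \<forall>\<epsilon>\<le>\<epsilon>\<^sub>0. (X, Y, \<gamma>) \<in> sdp_feasible A \<omega> \<epsilon>"
proof -
  define c where "c = 1 + \<i> * of_real \<omega>"
  define r where "r = sqrt ((norm c)\<^sup>2 - 1 / \<mu>\<^sup>2)"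
  let ?A = "complex_matrix A"
  note pb = pointwise_bound[OF assms(1) obj, folded c_def, folded r_def]
  have \<mu>: "0 < \<mu>" "1 / \<mu>\<^sup>2 \<le> (norm c)\<^sup>2" by (rule pb; assumption)+
  have "0 < \<gamma>" using \<mu> assms(3) by simp
  have r: "0 \<le> r" "r\<^sup>2 = (norm c)\<^sup>2 - 1 / \<mu>\<^sup>2" using \<mu> by (simp_all add: r_def)
  obtain T where T: "\<And>x. norm (T *v x) \<le> r * norm x"
    and Tc: "\<And>x. 0 \<le> (?A *v x) \<bullet> (T *v x - c *s x)"
    using uniform_contraction[OF r(1), of ?A c] pb(3) by blast
  have inv: "invertible ?A"
    using stable_matrix_kernel[OF assms(1)] by (metis invertible_left_inverse matrix_left_invertible_ker)
  \<comment> \<open>Chosen so that \<open>W\<close> paired with \<open>A x\<close> reproduces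
    \<open>T x - c x\<close>; this is possible because stability makes \<open>A\<close>
    invertible.\<close>
  define W where "W = \<gamma>\<^sup>2 *\<^sub>R adj ((T - mat c) ** matrix_inv ?A)"
  have W: "(?A *v x) \<bullet> (W *v u) = \<gamma>\<^sup>2 * ((T *v x - c *s x) \<bullet> u)" for x u
  proof -
    have "(?A *v x) \<bullet> (W *v u) = \<gamma>\<^sup>2 * ((((T - mat c) ** matrix_inv ?A) *v (?A *v x)) \<bullet> u)"
      unfolding W_def matrix_vector_mult_scaleR_left inner_scaleR_right inner_matrix_vec adj_adj ..
    also have "((T - mat c) ** matrix_inv ?A) *v (?A *v x) = T *v x - c *s x"
      by (simp add: matrix_inv_mult_vec[OF inv] matrix_vector_mult_diff_rdistrib flip: matrix_vector_mul_assoc)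
    finally show ?thesis .
  qed
  have accretive: "0 \<le> y \<bullet> (W *v y)" for y
  proof -
    have "y \<bullet> (W *v y) = (?A *v (matrix_inv ?A *v y)) \<bullet> (W *v (?A *v (matrix_inv ?A *v y)))"
      by (simp add: matrix_inv_mult_vec[OF inv])
    also have "\<dots> \<ge> 0"
      unfolding W using Tc[of "matrix_inv ?A *v y"] by (simp add: inner_commute)
    finally show ?thesis .
  qed
  \<comment> \<open>\<open>X\<close> is the Hermitian part of \<open>W\<close> and
    \<open>- Y\<close> its skew-Hermitian part, so that \<open>X - Y = W\<close>.\<close>
  define X where "X = (1 / 2) *\<^sub>R (W + adj W)"
  define Y where "Y = (1 / 2) *\<^sub>R (adj W - W)"
  have XY: "X - Y = W"
    by (simp add: X_def Y_def vec_eq_iff field_simps)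
  have X: "adj X = X" and Y: "adj Y = - Y"
    by (simp_all add: X_def Y_def adj_scaleR adj_add adj_diff add.commute flip: scaleR_minus_right)
  have "y \<bullet> (adj W *v y) = y \<bullet> (W *v y)" for y
    using inner_matrix_vec[of y W y] by (simp add: inner_commute)
  then have psd: "positive_semidefinite X"
    using accretive X
    by (simp add: positive_semidefinite_iff) (simp add: X_def matrix_vector_mult_add_rdistrib inner_add_right)
  have "v \<bullet> (sdp_lhs A \<omega> X Y \<gamma> *v v) < 0" if "v \<noteq> 0" for v
  proof -
    define x where "x = state A \<omega> v"
    define u where "u = ?A *v x + sqrt 2 *\<^sub>R upper v"
    note st = sdp_form_state(1)[OF assms(1) X Y, of v \<omega>, folded c_def x_def, folded u_def]
      sdp_form_state(2)[OF assms(1) X Y, of \<omega> "\<gamma>\<^sup>2" v, folded c_def x_def, folded u_def]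
    have "1 / \<gamma>\<^sup>2 < 1 / \<mu>\<^sup>2"
      using \<mu> assms(3) by (intro divide_strict_left_mono power_strict_mono) simp_all
    then have gap: "r\<^sup>2 < (norm c)\<^sup>2 - 1 / \<gamma>\<^sup>2" by (simp add: r)
    have Tx: "(norm (T *v x))\<^sup>2 \<le> r\<^sup>2 * (norm x)\<^sup>2"
      using power_mono[OF T[of x], of 2] by (simp add: power_mult_distrib)
    have nz: "x \<noteq> 0 \<or> u \<noteq> 0"
    proof (rule ccontr)
      assume "\<not> ?thesis"
      then have "x = 0" "u = 0" by auto
      then have "upper v = 0" "lower v = 0" using st(1) by (simp_all add: u_def)
      then show False using that upper_lower_eqI[of v 0] by simp
    qed
    have "sdp_form A \<omega> X Y (\<gamma>\<^sup>2) v
        = 2 * \<gamma>\<^sup>2 * ((T *v x - c *s x) \<bullet> u) + (norm x)\<^sup>2 - \<gamma>\<^sup>2 * (norm (c *s x - u))\<^sup>2"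
      unfolding st(2) XY W by simp
    \<comment> \<open>Completing the square in \<open>u\<close>: for fixed \<open>x\<close> the form
      is largest at \<open>u = T x\<close>.\<close>
    also have "\<dots> = - \<gamma>\<^sup>2 * ((norm (u - T *v x))\<^sup>2 - (norm (T *v x))\<^sup>2 + ((norm c)\<^sup>2 - 1 / \<gamma>\<^sup>2) * (norm x)\<^sup>2)"
    proof -
      have norm1: "(norm (c *s x - u))\<^sup>2 = (norm c)\<^sup>2 * (norm x)\<^sup>2 - 2 * ((c *s x) \<bullet> u) + (norm u)\<^sup>2"
        by (simp add: norm_diff_square power_mult_distrib)
      have norm2: "(norm (u - T *v x))\<^sup>2 = (norm u)\<^sup>2 - 2 * ((T *v x) \<bullet> u) + (norm (T *v x))\<^sup>2"
        by (simp add: norm_diff_square inner_commute)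
      show ?thesis
        unfolding norm1 norm2 inner_diff_left using \<open>0 < \<gamma>\<close> by (simp add: algebra_simps)
    qed
    also have "\<dots> < 0"
    proof -
      have "0 < (norm (u - T *v x))\<^sup>2 + ((norm c)\<^sup>2 - 1 / \<gamma>\<^sup>2 - r\<^sup>2) * (norm x)\<^sup>2"
      proof (cases "x = 0")
        case True
        then show ?thesis using nz by simp
      next
        case False
        then show ?thesis using gap by (intro add_nonneg_pos mult_pos_pos) simp_all
      qed
      then have "0 < (norm (u - T *v x))\<^sup>2 - (norm (T *v x))\<^sup>2 + ((norm c)\<^sup>2 - 1 / \<gamma>\<^sup>2) * (norm x)\<^sup>2"
        using Tx by (simp add: algebra_simps)
      then show ?thesis using \<open>0 < \<gamma>\<close> by simp
    qed
    finally show ?thesis by (simp add: sdp_lhs_form)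
  qed
  then obtain \<epsilon>\<^sub>0 where \<epsilon>\<^sub>0: "\<epsilon>\<^sub>0 > 0" "\<And>v. sdp_form A \<omega> X Y (\<gamma>\<^sup>2) v \<le> - \<epsilon>\<^sub>0 * (norm v)\<^sup>2"
    using negative_definite_gap[of "sdp_lhs A \<omega> X Y \<gamma>"] by (auto simp: sdp_lhs_form)
  have "(X, Y, \<gamma>) \<in> sdp_feasible A \<omega> \<epsilon>" if "\<epsilon> \<le> \<epsilon>\<^sub>0" for \<epsilon>
  proof -
    have "- \<epsilon>\<^sub>0 * (norm v)\<^sup>2 \<le> - \<epsilon> * (norm v)\<^sup>2" for v :: "complex^('n + 'n)"
      using that by (intro mult_right_mono) simp_all
    then show ?thesis
      using \<epsilon>\<^sub>0(2) Y psd \<open>0 < \<gamma>\<close> unfolding sdp_feasible_iff by (meson less_imp_le order_trans)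
  qed
  then show ?thesis using \<epsilon>\<^sub>0(1) by blast
qed

theorem theorem3:
  fixes A :: "real^'n^'n" and \<omega> :: real
  assumes "stable_matrix A" and "0 \<le> \<omega>"
  shows "(\<forall>\<epsilon>>0. convex (sdp_feasible_squared A \<omega> \<epsilon>)) \<and>
    (\<exists>\<delta>\<^sub>0. is_arg_max (inner_objective A \<omega>) (\<lambda>\<delta>. \<delta> \<in> {-1..1}) \<delta>\<^sub>0 \<and>
      ((\<lambda>\<epsilon>. sdp_value A \<omega> \<epsilon>) \<longlongrightarrow> ereal (inner_objective A \<omega> \<delta>\<^sub>0)) (at_right 0))"
proof -
  obtain \<delta>\<^sub>0 where \<delta>\<^sub>0: "\<delta>\<^sub>0 \<in> {-1..1}"
    and max: "\<And>\<delta>. \<delta> \<in> {-1..1} \<Longrightarrow> inner_objective A \<omega> \<delta> \<le> inner_objective A \<omega> \<delta>\<^sub>0"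
    using inner_objective_attains_sup[OF assms(1)] by blast
  let ?\<mu> = "inner_objective A \<omega> \<delta>\<^sub>0"
  have "is_arg_max (inner_objective A \<omega>) (\<lambda>\<delta>. \<delta> \<in> {-1..1}) \<delta>\<^sub>0"
    using \<delta>\<^sub>0 max by (simp add: is_arg_max_def not_less)
  moreover have "((\<lambda>\<epsilon>. sdp_value A \<omega> \<epsilon>) \<longlongrightarrow> ereal ?\<mu>) (at_right 0)"
  proof (rule order_tendstoI)
    fix l assume l: "l < ereal ?\<mu>"
    \<comment> \<open>The lower bound holds for every positive \<epsilon>; the upper bound below
      needs \<epsilon> small, depending on how close \<gamma> is to the maximum.\<close>
    have "ereal ?\<mu> \<le> sdp_value A \<omega> \<epsilon>" if "0 < \<epsilon>" for \<epsilon>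
      unfolding sdp_value_def
      using inner_objective_le_feasible[OF assms(1) that _ \<delta>\<^sub>0] by (intro INF_greatest) auto
    then show "\<forall>\<^sub>F \<epsilon> in at_right 0. l < sdp_value A \<omega> \<epsilon>"
      using l eventually_at_right_less[of "0::real"]
      by (auto elim!: eventually_mono intro: less_le_trans)
  next
    fix h assume "ereal ?\<mu> < h"
    then obtain \<gamma> where \<gamma>: "?\<mu> < \<gamma>" "ereal \<gamma> < h"
      using ereal_dense2 by (metis less_ereal.simps(1))
    \<comment> \<open>One pair \<open>X\<close>, \<open>Y\<close> serves all small \<epsilon> at
      once.\<close>
    obtain X Y \<epsilon>\<^sub>0 where "\<epsilon>\<^sub>0 > 0" and feas: "\<And>\<epsilon>. \<epsilon> \<le> \<epsilon>\<^sub>0 \<Longrightarrow> (X, Y, \<gamma>) \<in> sdp_feasible A \<omega> \<epsilon>"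
      using sdp_strictly_feasible[OF assms(1) max \<gamma>(1)] by blast
    have "sdp_value A \<omega> \<epsilon> < h" if "\<epsilon> < \<epsilon>\<^sub>0" for \<epsilon>
    proof -
      have "sdp_value A \<omega> \<epsilon> \<le> ereal \<gamma>"
        unfolding sdp_value_def using INF_lower[OF feas[of \<epsilon>], of "\<lambda>(X, Y, \<gamma>). ereal \<gamma>"] that by simp
      then show ?thesis using \<gamma>(2) by simp
    qed
    then show "\<forall>\<^sub>F \<epsilon> in at_right 0. sdp_value A \<omega> \<epsilon> < h"
      using eventually_at_right_real[OF \<open>\<epsilon>\<^sub>0 > 0\<close>] by (auto elim!: eventually_mono)
  qed
  ultimately show ?thesis using convex_sdp_feasible_squared by blast
qed

end
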